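(* Let $C=\{(x_1,x_2,x_3)\in\mathbb{R}^3 : x_1^2+x_2^2\le r^2,\ 0\le x_3\le d\}$, with $0<r<\frac{d}{2}$. If $\Sigma\subset C$ is a compact embedded constant mean curvature surface with mean curvature $H$ (with respect to the inward pointing normal) and boundary in the planes $P_0=\{x_3=0\}$ and $P_d=\{x_3=d\}$, then $$H>\frac{d^2-12r^2}{2r(d^2-4r^2)}-\frac{32r^2d^2}{(d^2-4r^2)^3}.$$ Thus when $d$ is large relative to $r$, the mean curvature $H$ of $\Sigma$ is bounded away from zero. Furthermore, the limiting value of this lower bound as $d\to\infty$ is equal to the mean curvature of a cylinder of radius $r$.
   Context: The mean curvature is the average of the two principal curvatures, with the sign convention that a round cylinder of radius $r$ has mean curvature $\frac{1}{2r}$ with respect to its inward pointing normal. The inward pointing normal of $\Sigma$ is the unit normal pointing into the region that $\Sigma$ encloses together with the planes $P_0$ and $P_d$.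
   Formalization: The surface is taken to be connected, with boundary meeting both planes P_0 and P_d (and smooth up to its boundary); otherwise the bound fails, e.g. for a shallow spherical cap over P_0, or one such cap over each plane, whose mean curvature can be arbitrarily small. *)

theory Defs
  imports "HOL-Analysis.Analysis"
begin

section \<open>Smooth maps and embedded surfaces with boundary\<close>

text \<open>
  \<open>Ck_on k f U\<close> is meant for open \<open>U\<close>: \<open>f\<close> is \<open>C\<^sup>k\<close> iff it is (Frechet) differentiable and each of
  its directional derivatives is \<open>C\<^sup>k\<^sup>-\<^sup>1\<close>.
\<close>

primrec Ck_on :: "nat \<Rightarrow> ('a::euclidean_space \<Rightarrow> 'b::euclidean_space) \<Rightarrow> 'a set \<Rightarrow> bool" where
  "Ck_on 0 f U \<longleftrightarrow> continuous_on U f"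
| "Ck_on (Suc k) f U \<longleftrightarrow>
     (\<exists>f'. (\<forall>x\<in>U. (f has_derivative f' x) (at x)) \<and> (\<forall>v. Ck_on k (\<lambda>x. f' x v) U))"

definition smooth_on :: "'a::euclidean_space set \<Rightarrow> ('a \<Rightarrow> 'b::euclidean_space) \<Rightarrow> bool" where
  "smooth_on U f \<longleftrightarrow> (\<forall>k. Ck_on k f U)"

definition diffeomorphism ::
    "'a::euclidean_space set \<Rightarrow> 'b::euclidean_space set \<Rightarrow> ('a \<Rightarrow> 'b) \<Rightarrow> ('b \<Rightarrow> 'a) \<Rightarrow> bool" where
  "diffeomorphism U W f g \<longleftrightarrow>
     open U \<and> open W \<and> homeomorphism U W f g \<and> smooth_on U f \<and> smooth_on W g"

text \<open>
  Adapted charts of the ambient space: near an interior point the surface is straightened to the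
  plane \<open>y\<^sub>3 = 0\<close>, near a boundary point to the closed half-plane \<open>y\<^sub>3 = 0, y\<^sub>2 \<ge> 0\<close>, with the point
  itself going to the edge.
\<close>

definition interior_point :: "(real^3) set \<Rightarrow> real^3 \<Rightarrow> bool" where
  "interior_point S p \<longleftrightarrow> p \<in> S \<and>
     (\<exists>(U::(real^3) set) (W::(real^3) set) f g. p \<in> U \<and> diffeomorphism U W f g \<and> f ` (S \<inter> U) = W \<inter> {y. y$3 = 0})"

definition boundary_point :: "(real^3) set \<Rightarrow> real^3 \<Rightarrow> bool" where
  "boundary_point S p \<longleftrightarrow> p \<in> S \<and>
     (\<exists>(U::(real^3) set) (W::(real^3) set) f g. p \<in> U \<and> diffeomorphism U W f g \<and>
        f ` (S \<inter> U) = W \<inter> {y. y$3 = 0 \<and> y$2 \<ge> 0} \<and> f p $ 2 = 0)"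

definition embedded_surface :: "(real^3) set \<Rightarrow> bool" where
  "embedded_surface S \<longleftrightarrow> (\<forall>p\<in>S. interior_point S p \<or> boundary_point S p)"

definition surface_boundary :: "(real^3) set \<Rightarrow> (real^3) set" where
  "surface_boundary S = {p. boundary_point S p}"


section \<open>Mean curvature\<close>

text \<open>
  The tangent space is spanned by the initial velocities of curves in \<open>S\<close> starting at \<open>p\<close>. The curves
  are one-sided and the span is taken so that the full tangent plane is also obtained at boundary
  points.
\<close>

definition tangent_space :: "(real^3) set \<Rightarrow> real^3 \<Rightarrow> (real^3) set" where
  "tangent_space S p = span {v. \<exists>\<gamma> \<epsilon>. \<epsilon> > 0 \<and> \<gamma> ` {0..<\<epsilon>} \<subseteq> S \<and> \<gamma> 0 = p \<and>
                                  (\<gamma> has_vector_derivative v) (at 0 within {0..<\<epsilon>})}"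

definition unit_normal_field :: "(real^3) set \<Rightarrow> (real^3 \<Rightarrow> real^3) \<Rightarrow> bool" where
  "unit_normal_field S N \<longleftrightarrow> continuous_on S N \<and>
     (\<forall>p\<in>S. norm (N p) = 1 \<and> (\<forall>v\<in>tangent_space S p. N p \<bullet> v = 0))"

text \<open>
  The principal curvatures are the eigenvalues, with multiplicity, of the shape operator \<open>-dN\<close> on the
  tangent plane. The derivative \<open>A\<close> of \<open>N\<close> within \<open>S\<close> is only determined on the tangent plane, which
  is where it is used. With this sign a round cylinder has positive mean curvature with respect to
  the normal that points to its axis.
\<close>

definition principal_curvatures ::
    "(real^3) set \<Rightarrow> (real^3 \<Rightarrow> real^3) \<Rightarrow> real^3 \<Rightarrow> real \<Rightarrow> real \<Rightarrow> bool" where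
  "principal_curvatures S N p \<kappa>\<^sub>1 \<kappa>\<^sub>2 \<longleftrightarrow>
     (\<exists>A e\<^sub>1 e\<^sub>2. (N has_derivative A) (at p within S) \<and>
        norm e\<^sub>1 = 1 \<and> norm e\<^sub>2 = 1 \<and> e\<^sub>1 \<bullet> e\<^sub>2 = 0 \<and> tangent_space S p = span {e\<^sub>1, e\<^sub>2} \<and>
        - A e\<^sub>1 = \<kappa>\<^sub>1 *\<^sub>R e\<^sub>1 \<and> - A e\<^sub>2 = \<kappa>\<^sub>2 *\<^sub>R e\<^sub>2)"

definition has_mean_curvature ::
    "(real^3) set \<Rightarrow> (real^3 \<Rightarrow> real^3) \<Rightarrow> real^3 \<Rightarrow> real \<Rightarrow> bool" where
  "has_mean_curvature S N p H \<longleftrightarrow>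
     (\<exists>\<kappa>\<^sub>1 \<kappa>\<^sub>2. principal_curvatures S N p \<kappa>\<^sub>1 \<kappa>\<^sub>2 \<and> H = (\<kappa>\<^sub>1 + \<kappa>\<^sub>2) / 2)"

definition has_constant_mean_curvature ::
    "(real^3) set \<Rightarrow> (real^3 \<Rightarrow> real^3) \<Rightarrow> real \<Rightarrow> bool" where
  "has_constant_mean_curvature S N H \<longleftrightarrow>
     unit_normal_field S N \<and> (\<forall>p\<in>S. has_mean_curvature S N p H)"


section \<open>Surfaces between two parallel planes\<close>

definition plane :: "real \<Rightarrow> (real^3) set" where
  "plane h = {x. x$3 = h}"

definition solid_cylinder :: "real \<Rightarrow> real \<Rightarrow> (real^3) set" where
  "solid_cylinder r d = {x. (x$1)\<^sup>2 + (x$2)\<^sup>2 \<le> r\<^sup>2 \<and> 0 \<le> x$3 \<and> x$3 \<le> d}"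

definition enclosed_region :: "real \<Rightarrow> (real^3) set \<Rightarrow> (real^3) set" where
  "enclosed_region d S = inside (S \<union> plane 0 \<union> plane d)"

text \<open>
  Inward pointing is only required off the two planes: at a point of \<open>S\<close> on a plane, for instance a
  boundary point, the segment in direction \<open>N p\<close> may leave the slab. There \<open>N\<close> is determined by
  continuity.
\<close>

definition points_inward :: "real \<Rightarrow> (real^3) set \<Rightarrow> (real^3 \<Rightarrow> real^3) \<Rightarrow> bool" where
  "points_inward d S N \<longleftrightarrow>
     (\<forall>p \<in> S - (plane 0 \<union> plane d).
        \<exists>\<epsilon>>0. \<forall>t. 0 < t \<and> t < \<epsilon> \<longrightarrow> p + t *\<^sub>R N p \<in> enclosed_region d S)"

text \<open>
  Having boundary in the planes \<open>plane 0\<close> and \<open>plane d\<close> means that the boundary is contained in their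
  union and meets both of them, and surfaces are connected. Shallow spherical caps over one of the
  planes, or a pair of them over the two planes, have arbitrarily small mean curvature.
\<close>

definition cmc_surface_in_cylinder ::
    "real \<Rightarrow> real \<Rightarrow> (real^3) set \<Rightarrow> (real^3 \<Rightarrow> real^3) \<Rightarrow> real \<Rightarrow> bool" where
  "cmc_surface_in_cylinder r d S N H \<longleftrightarrow>
     S \<subseteq> solid_cylinder r d \<and> compact S \<and> connected S \<and> embedded_surface S \<and>
     surface_boundary S \<subseteq> plane 0 \<union> plane d \<and>
     surface_boundary S \<inter> plane 0 \<noteq> {} \<and> surface_boundary S \<inter> plane d \<noteq> {} \<and>
     has_constant_mean_curvature S N H \<and> points_inward d S N"

definition mean_curvature_bound :: "real \<Rightarrow> real \<Rightarrow> real" where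
  "mean_curvature_bound r d =
     (d\<^sup>2 - 12 * r\<^sup>2) / (2 * r * (d\<^sup>2 - 4 * r\<^sup>2)) - 32 * r\<^sup>2 * d\<^sup>2 / (d\<^sup>2 - 4 * r\<^sup>2) ^ 3"

definition round_cylinder :: "real \<Rightarrow> (real^3) set" where
  "round_cylinder r = {x. (x$1)\<^sup>2 + (x$2)\<^sup>2 = r\<^sup>2}"

definition round_cylinder_normal :: "real \<Rightarrow> real^3 \<Rightarrow> real^3" where
  "round_cylinder_normal r x = vector [- (x$1 / r), - (x$2 / r), 0]"

end

theory Submission
  imports Defs "HOL-Real_Asymp.Real_Asymp"
begin

text \<open>
  Bend the half-tube of radius \<open>r\<close> around a circle of radius \<open>m + r\<close>: the inner half of the resulting
  torus has mean curvature at least \<open>1/(2r) - 1/(2m)\<close>. Rotate so that \<open>S\<close> has a point at height \<open>d/2\<close>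
  straight above a nonnegative multiple of a horizontal unit vector \<open>a\<close>, and push the half-torus in
  the direction \<open>- a\<close> towards \<open>S\<close> until
  first contact. If \<open>8rm < d\<^sup>2 - 4r\<^sup>2\<close>, the sagitta of the arc over the slab exceeds \<open>r\<close>, so contact
  cannot occur on the two planes. On the edge of the half-tube, contact means that \<open>S\<close> touches the
  wall of the solid cylinder, where \<open>H \<ge> 1/(2r)\<close>. Elsewhere \<open>S\<close> touches the torus from inside the
  tube, so \<open>H\<close> is at least the mean curvature of the torus. Letting \<open>m\<close> increase to
  \<open>(d\<^sup>2 - 4r\<^sup>2)/(8r)\<close> gives the first term of the bound, and the second term makes it strict.
\<close>

section \<open>Curves on a surface\<close>

text \<open>If \<open>k > 0\<close>, then \<open>c'\<close> is positive just to the right of 0 and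
  the mean value theorem lifts \<open>c\<close> above \<open>c 0\<close>. The second derivative is
  taken at 0 only, which is what \<open>interior_point_curve\<close> provides.\<close>

lemma second_derivative_nonpos_at_max:
  fixes c c' :: "real \<Rightarrow> real"
  assumes "\<delta> > 0"
    and c: "\<And>t. \<bar>t\<bar> < \<delta> \<Longrightarrow> (c has_real_derivative c' t) (at t)"
    and le: "\<And>t. \<bar>t\<bar> < \<delta> \<Longrightarrow> c t \<le> c 0"
    and c': "(c' has_real_derivative k) (at 0)"
  shows "c' 0 = 0" "k \<le> 0"
proof -
  show 0: "c' 0 = 0"
    using DERIV_local_max[OF c[of 0] \<open>\<delta> > 0\<close>] le \<open>\<delta> > 0\<close> by auto
  show "k \<le> 0"
  proof (rule ccontr)
    assume "\<not> k \<le> 0"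
    then obtain d where d: "d > 0" "\<And>h. 0 < h \<Longrightarrow> h < d \<Longrightarrow> c' h > 0"
      using DERIV_pos_inc_right[OF c'] 0 by auto
    define h where "h = min d \<delta> / 2"
    have h: "0 < h" "h < d" "h < \<delta>" using d \<open>\<delta> > 0\<close> by (auto simp: h_def)
    have "\<exists>z>0. z < h \<and> c h - c 0 = (h - 0) * c' z"
      by (rule MVT2) (use h c in auto)
    then obtain z where "0 < z" "z < h" "c h - c 0 = h * c' z" by auto
    moreover have "h * c' z > 0" using d h \<open>0 < z\<close> \<open>z < h\<close> by simp
    ultimately show False using le[of h] h by auto
  qed
qed

lemma tangent_space_velocity:
  assumes "\<epsilon> > 0" "\<And>t. 0 \<le> t \<Longrightarrow> t < \<epsilon> \<Longrightarrow> \<gamma> t \<in> S" "\<gamma> 0 = p"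
    "(\<gamma> has_vector_derivative v) (at 0)"
  shows "v \<in> tangent_space S p"
  unfolding tangent_space_def
proof (rule span_base, rule CollectI, intro exI conjI)
  show "\<gamma> ` {0..<\<epsilon>} \<subseteq> S" using assms by auto
  show "(\<gamma> has_vector_derivative v) (at 0 within {0..<\<epsilon>})"
    using assms(4) has_vector_derivative_at_within by blast
qed (use assms in auto)

lemma at_within_half_open_nontrivial: "\<epsilon> > 0 \<Longrightarrow> at (0::real) within {0..<\<epsilon>} \<noteq> bot"
  by (simp add: trivial_limit_within islimpt_greaterThanLessThan1 
      islimpt_subset[OF islimpt_greaterThanLessThan1, of 0 \<epsilon>] subset_iff)

text \<open>The chart flattens \<open>S\<close>, so \<open>f'\<close> sends every velocity to a
  vector with third coordinate 0, and \<open>g'\<close> inverts \<open>f'\<close>. The images under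
  \<open>g'\<close> of such vectors form a subspace, which extends the claim from velocities to
  their span.\<close>

lemma chart_tangent_velocity:
  fixes f g :: "real^3 \<Rightarrow> real^3"
  assumes U: "p \<in> U" "open U" and p: "p \<in> S"
    and hom: "homeomorphism U W f g"
    and img: "f ` (S \<inter> U) = W \<inter> {y. y$3 = 0}"
    and f': "(f has_derivative f') (at p)" and g': "(g has_derivative g') (at (f p))"
    and e: "e \<in> tangent_space S p"
  shows "\<exists>w. w$3 = 0 \<and> g' w = e"
proof -
  have gf: "\<And>x. x \<in> U \<Longrightarrow> g (f x) = x"
    using hom by (auto simp: homeomorphism_def)
  have "((\<lambda>x. g (f x)) has_derivative (\<lambda>x. g' (f' x))) (at p)"
    using has_derivative_compose[OF f' g'] .
  then have "((\<lambda>x. x) has_derivative (\<lambda>x. g' (f' x))) (at p)"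
    by (rule has_derivative_transform_within_open) (use U gf in auto)
  then have inv: "g' (f' x) = x" for x
    using has_derivative_unique[OF _ has_derivative_ident] by metis
  interpret g': bounded_linear g' using g' has_derivative_bounded_linear by blast
  let ?V = "g' ` {w. w$3 = 0}"
  have sub: "subspace ?V"
    by (rule linear_subspace_image)
       (auto simp: subspace_def intro: g'.linear)
  have "{v. \<exists>\<gamma> \<epsilon>. \<epsilon> > 0 \<and> \<gamma> ` {0..<\<epsilon>} \<subseteq> S \<and> \<gamma> 0 = p \<and>
            (\<gamma> has_vector_derivative v) (at 0 within {0..<\<epsilon>})} \<subseteq> ?V"
  proof clarify
    fix v and \<gamma> :: "real \<Rightarrow> real^3" and \<epsilon> :: real
    assume \<epsilon>: "\<epsilon> > 0" and S: "\<gamma> ` {0..<\<epsilon>} \<subseteq> S" and p0: "p = \<gamma> 0"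
      and v: "(\<gamma> has_vector_derivative v) (at 0 within {0..<\<epsilon>})"
    have "continuous (at 0 within {0..<\<epsilon>}) \<gamma>"
      using v has_vector_derivative_continuous by blast
    then have "eventually (\<lambda>t. \<gamma> t \<in> U) (at 0 within {0..<\<epsilon>})"
      using U p0 by (auto simp: continuous_within topological_tendstoD)
    then obtain d where d: "d > 0" "\<And>t. t \<in> {0..<\<epsilon>} \<Longrightarrow> t \<noteq> 0 \<Longrightarrow> dist t 0 < d \<Longrightarrow> \<gamma> t \<in> U"
      unfolding eventually_at by blast
    define \<eta> where "\<eta> = min d \<epsilon>"
    have \<eta>: "\<eta> > 0" "{0..<\<eta>} \<subseteq> {0..<\<epsilon>}" using d \<epsilon> by (auto simp: \<eta>_def)
    have z: "f (\<gamma> t) $ 3 = 0" if "t \<in> {0..<\<eta>}" for t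
    proof -
      have "\<gamma> t \<in> S \<inter> U"
        using that S d(2)[of t] U p0 \<eta> by (cases "t = 0") (auto simp: \<eta>_def)
      then show ?thesis using img by blast
    qed
    have "(\<gamma> has_derivative (\<lambda>t. t *\<^sub>R v)) (at 0 within {0..<\<eta>})"
      using v \<eta>(2) has_derivative_subset unfolding has_vector_derivative_def by blast
    then have "((\<lambda>t. f (\<gamma> t)) has_derivative (\<lambda>t. f' (t *\<^sub>R v))) (at 0 within {0..<\<eta>})"
      using has_derivative_compose f' p0 by blast
    then have "((\<lambda>t. f (\<gamma> t) $ 3) has_derivative (\<lambda>t. f' (t *\<^sub>R v) $ 3)) (at 0 within {0..<\<eta>})"
      by (rule bounded_linear.has_derivative[OF bounded_linear_vec_nth])
    then have "((\<lambda>t. f (\<gamma> t) $ 3) has_vector_derivative f' v $ 3) (at 0 within {0..<\<eta>})"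
      using linear_simps(5)[OF has_derivative_bounded_linear[OF f']]
      by (simp add: has_vector_derivative_def)
    then have "((\<lambda>t. 0) has_vector_derivative f' v $ 3) (at 0 within {0..<\<eta>})"
      by (rule has_vector_derivative_transform[rotated 2]) (use \<eta> z in auto)
    then have "f' v $ 3 = 0"
      using vector_derivative_unique_within[OF at_within_half_open_nontrivial[OF \<eta>(1)]]
        has_vector_derivative_const by blast
    then show "v \<in> ?V" using inv[of v] by (metis (mono_tags, lifting) image_eqI mem_Collect_eq)
  qed
  then have "tangent_space S p \<subseteq> ?V"
    unfolding tangent_space_def using sub by (rule span_minimal)
  then show ?thesis using e by auto
qed

text \<open>A straight segment in the chart, carried back by \<open>g\<close>, inherits its two
  derivatives from \<open>g\<close>. Thus every element of the span is the velocity of a two-sided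
  curve, as a second derivative test requires.\<close>

lemma interior_point_curve:
  assumes S: "interior_point S p" and e: "e \<in> tangent_space S p"
  obtains \<gamma> \<gamma>' q \<delta> where "\<delta> > 0" "\<gamma> 0 = p" "\<gamma>' 0 = e"
    "\<And>t. \<bar>t\<bar> < \<delta> \<Longrightarrow> \<gamma> t \<in> S"
    "\<And>t. \<bar>t\<bar> < \<delta> \<Longrightarrow> (\<gamma> has_vector_derivative \<gamma>' t) (at t)"
    "\<And>t. \<bar>t\<bar> < \<delta> \<Longrightarrow> \<gamma>' t \<in> tangent_space S (\<gamma> t)"
    "(\<gamma>' has_vector_derivative q) (at 0)"
proof -
  from S obtain U W :: "(real^3) set" and f g where "p \<in> S" and p: "p \<in> U"
    and diff: "diffeomorphism U W f g" and img: "f ` (S \<inter> U) = W \<inter> {y. y$3 = 0}"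
    unfolding interior_point_def by blast
  have op: "open U" "open W" and hom: "homeomorphism U W f g"
    and "Ck_on (Suc 0) f U" "Ck_on (Suc (Suc 0)) g W"
    using diff unfolding diffeomorphism_def smooth_on_def by auto
  then obtain f' g' where f': "\<And>x. x \<in> U \<Longrightarrow> (f has_derivative f' x) (at x)"
    and g': "\<And>x. x \<in> W \<Longrightarrow> (g has_derivative g' x) (at x)"
    and "\<And>v. Ck_on (Suc 0) (\<lambda>x. g' x v) W"
    unfolding Ck_on.simps by metis
  then have "\<forall>v. \<exists>D. \<forall>x\<in>W. ((\<lambda>x. g' x v) has_derivative D x) (at x)"
    by simp metis
  then obtain g'' where g'': "\<And>v x. x \<in> W \<Longrightarrow> ((\<lambda>x. g' x v) has_derivative g'' v x) (at x)"
    by metis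
  have gf: "\<And>x. x \<in> U \<Longrightarrow> g (f x) = x" and fp: "f p \<in> W"
    using hom p by (auto simp: homeomorphism_def)
  obtain w where w: "w $ 3 = 0" "g' (f p) w = e"
    using chart_tangent_velocity[OF p op(1) \<open>p \<in> S\<close> hom img f'[OF p] g'[OF fp] e] by blast
  have fp3: "f p $ 3 = 0" using img \<open>p \<in> S\<close> p by blast
  define l where "l = (\<lambda>t::real. f p + t *\<^sub>R w)"
  have l: "(l has_vector_derivative w) (at t)" for t
    unfolding l_def by (auto intro!: derivative_eq_intros)
  have "open (l -` W)"
    by (rule continuous_open_vimage) (auto simp: op l_def intro!: continuous_intros)
  then obtain \<delta> where \<delta>: "\<delta> > 0" "\<And>t. \<bar>t\<bar> < \<delta> \<Longrightarrow> l t \<in> W"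
    using fp unfolding open_dist by (auto simp: l_def dest!: bspec[of _ _ 0])
  define \<gamma> where "\<gamma> = (\<lambda>t. g (l t))"
  define \<gamma>' where "\<gamma>' = (\<lambda>t. g' (l t) w)"
  have inS: "\<gamma> t \<in> S" if "\<bar>t\<bar> < \<delta>" for t
  proof -
    have "l t \<in> f ` (S \<inter> U)" using \<delta>(2)[OF that] fp3 w by (auto simp: img l_def)
    then show ?thesis using gf by (auto simp: \<gamma>_def)
  qed
  have d1: "(\<gamma> has_vector_derivative \<gamma>' t) (at t)" if "\<bar>t\<bar> < \<delta>" for t
  proof -
    have "(\<gamma> has_derivative (\<lambda>s. g' (l t) (s *\<^sub>R w))) (at t)"
      unfolding \<gamma>_def using has_derivative_compose[OF l[unfolded has_vector_derivative_def] g'[OF \<delta>(2)[OF that]]] .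
    then show ?thesis
      using linear_simps(5)[OF has_derivative_bounded_linear[OF g'[OF \<delta>(2)[OF that]]]]
      by (simp add: has_vector_derivative_def \<gamma>'_def)
  qed
  have d2: "(\<gamma>' has_vector_derivative g'' w (f p) w) (at 0)"
  proof -
    have l0: "l 0 = f p" by (simp add: l_def)
    have "(\<gamma>' has_derivative (\<lambda>s. g'' w (f p) (s *\<^sub>R w))) (at 0)"
      unfolding \<gamma>'_def using has_derivative_compose[OF l[of 0, unfolded has_vector_derivative_def]] g''[OF fp] l0
      by auto
    then show ?thesis
      using linear_simps(5)[OF has_derivative_bounded_linear[OF g''[OF fp]]]
      by (simp add: has_vector_derivative_def)
  qed
  \<comment> \<open>The curve restarted at time \<open>t\<close> stays in \<open>S\<close> for the
    time \<open>\<delta> - \<bar>t\<bar>\<close>, so its velocity there is tangent as well.\<close>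
  have tan: "\<gamma>' t \<in> tangent_space S (\<gamma> t)" if t: "\<bar>t\<bar> < \<delta>" for t
  proof (rule tangent_space_velocity[of "\<delta> - \<bar>t\<bar>" "\<lambda>s. \<gamma> (t + s)"])
    have "((\<lambda>s. t + s) has_vector_derivative 1) (at 0)"
      by (auto intro!: derivative_eq_intros)
    from vector_diff_chain_at[OF this, of \<gamma> "\<gamma>' t"] d1[OF t]
    show "((\<lambda>s. \<gamma> (t + s)) has_vector_derivative \<gamma>' t) (at 0)" by (simp add: o_def)
  qed (use t inS in auto)
  show ?thesis
  proof (rule that[OF \<delta>(1) _ _ inS d1 tan d2])
    show "\<gamma> 0 = p" "\<gamma>' 0 = e" using gf p w by (auto simp: \<gamma>_def \<gamma>'_def l_def)
  qed
qed


section \<open>Comparison at a point of contact\<close>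

lemma orthonormal_expansion:
  fixes e\<^sub>1 e\<^sub>2 n v :: "real^3"
  assumes "norm e\<^sub>1 = 1" "norm e\<^sub>2 = 1" "norm n = 1" "e\<^sub>1 \<bullet> e\<^sub>2 = 0" "n \<bullet> e\<^sub>1 = 0" "n \<bullet> e\<^sub>2 = 0"
  shows "v = (v \<bullet> e\<^sub>1) *\<^sub>R e\<^sub>1 + (v \<bullet> e\<^sub>2) *\<^sub>R e\<^sub>2 + (v \<bullet> n) *\<^sub>R n"
proof -
  have sq: "e\<^sub>1 \<bullet> e\<^sub>1 = 1" "e\<^sub>2 \<bullet> e\<^sub>2 = 1" "n \<bullet> n = 1"
    using assms by (simp_all add: dot_square_norm)
  let ?E = "{e\<^sub>1, e\<^sub>2, n}"
  have ne: "e\<^sub>1 \<noteq> e\<^sub>2" "e\<^sub>1 \<noteq> n" "e\<^sub>2 \<noteq> n" using assms sq by auto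
  have "pairwise orthogonal ?E"
    using assms by (auto simp: pairwise_def orthogonal_def inner_commute)
  moreover have "0 \<notin> ?E" using sq by auto
  ultimately have ind: "independent ?E" by (rule pairwise_orthogonal_independent)
  have "card ?E = 3" using ne by simp
  then have "span ?E = UNIV"
    using ind dim_eq_full[of ?E] dim_eq_card_independent[OF ind] by simp
  moreover define u where "u = v - ((v \<bullet> e\<^sub>1) *\<^sub>R e\<^sub>1 + (v \<bullet> e\<^sub>2) *\<^sub>R e\<^sub>2 + (v \<bullet> n) *\<^sub>R n)"
  ultimately have "u \<in> span ?E" by simp
  moreover have "orthogonal u y" if "y \<in> ?E" for y
    using that assms(4-6) sq inner_commute[of e\<^sub>1 e\<^sub>2] inner_commute[of n e\<^sub>1] inner_commute[of n e\<^sub>2]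
    by (elim insertE) (simp_all add: u_def orthogonal_def inner_diff_left inner_add_left)
  ultimately have "orthogonal u u" using orthogonal_to_span by blast
  then show ?thesis by (simp add: u_def orthogonal_self)
qed

text \<open>Used to evaluate traces over a tangent plane: the sum over the unknown
  \<open>e\<^sub>1\<close> and \<open>e\<^sub>2\<close> becomes the full square minus the normal
  part.\<close>

lemma orthonormal_parseval:
  fixes e\<^sub>1 e\<^sub>2 n v :: "real^3"
  assumes "norm e\<^sub>1 = 1" "norm e\<^sub>2 = 1" "norm n = 1" "e\<^sub>1 \<bullet> e\<^sub>2 = 0" "n \<bullet> e\<^sub>1 = 0" "n \<bullet> e\<^sub>2 = 0"
  shows "v \<bullet> v = (v \<bullet> e\<^sub>1)\<^sup>2 + (v \<bullet> e\<^sub>2)\<^sup>2 + (v \<bullet> n)\<^sup>2"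
proof -
  have "v \<bullet> v = v \<bullet> ((v \<bullet> e\<^sub>1) *\<^sub>R e\<^sub>1 + (v \<bullet> e\<^sub>2) *\<^sub>R e\<^sub>2 + (v \<bullet> n) *\<^sub>R n)"
    using orthonormal_expansion[OF assms, of v] by simp
  then show ?thesis by (simp add: inner_add_right power2_eq_square)
qed

text \<open>Along a curve in \<open>S\<close> with velocity \<open>e\<close> and acceleration
  \<open>q\<close>, the maximum gives \<open>G p \<bullet> q + B e \<bullet> e \<le> 0\<close>.
  Differentiating the orthogonality of \<open>N\<close> and the velocity gives
  \<open>N p \<bullet> q = - (A e \<bullet> e)\<close>, so \<open>q\<close> drops out when
  \<open>G p\<close> is normal.\<close>

lemma touching_second_order:
  assumes S: "interior_point S p" and nf: "unit_normal_field S N"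
    and N: "(N has_derivative A) (at p within S)"
    and \<phi>: "eventually (\<lambda>x. (\<phi> has_derivative (\<lambda>w. G x \<bullet> w)) (at x)) (nhds p)"
    and le: "eventually (\<lambda>x. x \<in> S \<longrightarrow> \<phi> x \<le> \<phi> p) (nhds p)"
    and G: "(G has_derivative B) (at p)"
    and e: "e \<in> tangent_space S p"
  shows "G p \<bullet> e = 0"
    and "G p = \<mu> *\<^sub>R N p \<Longrightarrow> B e \<bullet> e \<le> \<mu> * (A e \<bullet> e)"
proof -
  obtain \<gamma> \<gamma>' q \<delta> where \<delta>: "\<delta> > 0" and [simp]: "\<gamma> 0 = p" "\<gamma>' 0 = e"
    and inS: "\<And>t. \<bar>t\<bar> < \<delta> \<Longrightarrow> \<gamma> t \<in> S"
    and d1: "\<And>t. \<bar>t\<bar> < \<delta> \<Longrightarrow> (\<gamma> has_vector_derivative \<gamma>' t) (at t)"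
    and tan: "\<And>t. \<bar>t\<bar> < \<delta> \<Longrightarrow> \<gamma>' t \<in> tangent_space S (\<gamma> t)"
    and d2: "(\<gamma>' has_vector_derivative q) (at 0)"
    using interior_point_curve[OF S e] by metis
  have d1': "\<bar>t\<bar> < \<delta> \<Longrightarrow> (\<gamma> has_derivative (\<lambda>s. s *\<^sub>R \<gamma>' t)) (at t)" for t
    using d1 by (simp add: has_vector_derivative_def)
  have d2': "(\<gamma>' has_derivative (\<lambda>s. s *\<^sub>R q)) (at 0)"
    using d2 by (simp add: has_vector_derivative_def)
  obtain X where X: "open X" "p \<in> X" "\<And>x. x \<in> X \<Longrightarrow> (\<phi> has_derivative (\<lambda>w. G x \<bullet> w)) (at x)"
    "\<And>x. x \<in> X \<Longrightarrow> x \<in> S \<Longrightarrow> \<phi> x \<le> \<phi> p"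
    using eventually_conj[OF \<phi> le] unfolding eventually_nhds by metis
  have "continuous_on {-\<delta><..<\<delta>} \<gamma>"
    using d1 by (intro continuous_at_imp_continuous_on ballI) (metis abs_less_iff greaterThanLessThan_iff has_vector_derivative_continuous minus_less_iff)
  then have "open ({-\<delta><..<\<delta>} \<inter> \<gamma> -` X)"
    by (rule continuous_open_preimage[OF _ open_greaterThanLessThan X(1)])
  moreover have "0 \<in> {-\<delta><..<\<delta>} \<inter> \<gamma> -` X" using X \<delta> by simp
  ultimately obtain \<eta> where \<eta>: "\<eta> > 0" and sub: "ball 0 \<eta> \<subseteq> {-\<delta><..<\<delta>} \<inter> \<gamma> -` X"
    by (rule openE)
  have \<eta>\<delta>: "\<bar>t\<bar> < \<delta>" "\<gamma> t \<in> X" if "\<bar>t\<bar> < \<eta>" for t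
    using subsetD[OF sub, of t] that by auto
  define c where "c = (\<lambda>t. \<phi> (\<gamma> t))"
  define c' where "c' = (\<lambda>t. G (\<gamma> t) \<bullet> \<gamma>' t)"
  have c: "(c has_real_derivative c' t) (at t)" if "\<bar>t\<bar> < \<eta>" for t
    using has_derivative_compose[OF d1'[OF \<eta>\<delta>(1)[OF that]] X(3)[OF \<eta>\<delta>(2)[OF that]]]
    by (simp add: c_def c'_def has_field_derivative_def mult_commute_abs)
  have Gq: "((\<lambda>t. G (\<gamma> t)) has_derivative (\<lambda>s. B (s *\<^sub>R e))) (at 0)"
    using has_derivative_compose[OF d1'[of 0]] G \<delta> by simp
  have "(c' has_derivative (\<lambda>s. G (\<gamma> 0) \<bullet> (s *\<^sub>R q) + B (s *\<^sub>R e) \<bullet> \<gamma>' 0)) (at 0)"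
    unfolding c'_def by (rule has_derivative_inner[OF Gq d2'])
  then have c'': "(c' has_real_derivative (G p \<bullet> q + B e \<bullet> e)) (at 0)"
    using linear_simps(5)[OF has_derivative_bounded_linear[OF G]]
    by (simp add: has_field_derivative_def mult_commute_abs flip: distrib_left)
  have max: "c t \<le> c 0" if "\<bar>t\<bar> < \<eta>" for t
    using X(4)[OF \<eta>\<delta>(2)[OF that] inS[OF \<eta>\<delta>(1)[OF that]]] by (simp add: c_def)
  note second = second_derivative_nonpos_at_max[OF \<eta> c max c'']
  then show "G p \<bullet> e = 0" by (simp add: c'_def)
  have orth: "N (\<gamma> t) \<bullet> \<gamma>' t = 0" if "\<bar>t\<bar> < \<delta>" for t
    using nf inS[OF that] tan[OF that] unfolding unit_normal_field_def by blast
  \<comment> \<open>\<open>N\<close> is differentiable only within \<open>S\<close>; composing it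
    with a curve that stays in \<open>S\<close> on both sides of 0 yields an ordinary
    derivative.\<close>
  have "(N has_derivative A) (at (\<gamma> 0) within \<gamma> ` {-\<delta><..<\<delta>})"
    using N inS by (auto intro!: has_derivative_subset[OF N])
  then have "((\<lambda>t. N (\<gamma> t)) has_derivative (\<lambda>s. A (s *\<^sub>R e))) (at 0 within {-\<delta><..<\<delta>})"
    using has_derivative_in_compose[OF has_derivative_at_withinI[OF d1'[of 0]]] \<delta> by simp
  then have "((\<lambda>t. N (\<gamma> t)) has_derivative (\<lambda>s. A (s *\<^sub>R e))) (at 0)"
    using \<delta> by (simp add: at_within_open[OF _ open_greaterThanLessThan])
  from has_derivative_inner[OF this d2']
  have "((\<lambda>t. N (\<gamma> t) \<bullet> \<gamma>' t) has_derivative (\<lambda>s. N p \<bullet> (s *\<^sub>R q) + A (s *\<^sub>R e) \<bullet> e)) (at 0)"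
    by simp
  then have "((\<lambda>t. 0) has_derivative (\<lambda>s. N p \<bullet> (s *\<^sub>R q) + A (s *\<^sub>R e) \<bullet> e)) (at 0)"
    by (rule has_derivative_transform_within_open[where s="{-\<delta><..<\<delta>}"]) (use \<delta> orth in auto)
  then have "(\<lambda>s. N p \<bullet> (s *\<^sub>R q) + A (s *\<^sub>R e) \<bullet> e) = (\<lambda>s. 0)"
    using has_derivative_unique has_derivative_const by blast
  from fun_cong[OF this, of 1] have "N p \<bullet> q = - (A e \<bullet> e)" by simp
  moreover assume "G p = \<mu> *\<^sub>R N p"
  ultimately show "B e \<bullet> e \<le> \<mu> * (A e \<bullet> e)" using second(2) by simp
qed

text \<open>The ray is connected and unbounded, so it makes the component of \<open>x\<close> in the
  complement of \<open>X\<close> unbounded.\<close>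

lemma not_inside_if_ray_avoids:
  fixes x v :: "'a::euclidean_space"
  assumes "v \<noteq> 0" "\<And>s. s \<ge> 0 \<Longrightarrow> x + s *\<^sub>R v \<notin> X"
  shows "x \<notin> inside X"
proof
  assume "x \<in> inside X"
  then have bd: "bounded (connected_component_set (- X) x)"
    by (simp add: inside_def)
  let ?R = "(\<lambda>s. x + s *\<^sub>R v) ` {0..}"
  have "connected ?R"
    by (intro connected_continuous_image continuous_intros) auto
  moreover have "x \<in> ?R" by (rule image_eqI[of _ _ 0]) auto
  moreover have "?R \<subseteq> - X" using assms by auto
  ultimately have "?R \<subseteq> connected_component_set (- X) x" by (simp add: connected_component_maximal)
  with bd obtain M where M: "\<And>s. s \<ge> 0 \<Longrightarrow> norm (x + s *\<^sub>R v) \<le> M"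
    unfolding bounded_iff by blast
  define s where "s = (M + norm x + 1) / norm v"
  have "M \<ge> 0" using order_trans[OF norm_ge_zero M[of 0]] by simp
  then have "s \<ge> 0" by (simp add: s_def)
  moreover have "norm (s *\<^sub>R v) = M + norm x + 1" using assms \<open>M \<ge> 0\<close> by (simp add: s_def)
  moreover have "norm (s *\<^sub>R v) \<le> norm (x + s *\<^sub>R v) + norm x"
    using norm_triangle_ineq4[of "x + s *\<^sub>R v" x] by simp
  ultimately show False using M[of s] by simp
qed

text \<open>
  The assumption on \<open>v\<close> has two uses: at \<open>s = 0\<close> it says that \<open>\<phi>\<close> restricted to \<open>S\<close> is maximal at \<open>p\<close>,
  and along the ray it shows that points with \<open>\<phi> > \<phi> p\<close> are not enclosed, which fixes the sign of \<open>N p\<close>.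
\<close>

lemma mean_curvature_comparison:
  assumes cmc: "cmc_surface_in_cylinder r d S N H" and p: "p \<in> S" "0 < p$3" "p$3 < d"
    and \<phi>: "eventually (\<lambda>x. (\<phi> has_derivative (\<lambda>w. G x \<bullet> w)) (at x)) (nhds p)"
    and G: "(G has_derivative B) (at p)"
    and v: "v \<noteq> 0" "v$3 = 0"
    and esc: "eventually (\<lambda>x. \<phi> x > \<phi> p \<longrightarrow> (\<forall>s\<ge>0. x + s *\<^sub>R v \<notin> S)) (nhds p)"
  obtains e\<^sub>1 e\<^sub>2 n where "norm e\<^sub>1 = 1" "norm e\<^sub>2 = 1" "norm n = 1"
    "e\<^sub>1 \<bullet> e\<^sub>2 = 0" "n \<bullet> e\<^sub>1 = 0" "n \<bullet> e\<^sub>2 = 0" "G p = - norm (G p) *\<^sub>R n"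
    "B e\<^sub>1 \<bullet> e\<^sub>1 + B e\<^sub>2 \<bullet> e\<^sub>2 \<le> 2 * H * norm (G p)"
proof -
  have nf: "unit_normal_field S N" and "has_mean_curvature S N p H" and inw: "points_inward d S N"
    and emb: "embedded_surface S" and bdry: "surface_boundary S \<subseteq> plane 0 \<union> plane d"
    using cmc p unfolding cmc_surface_in_cylinder_def has_constant_mean_curvature_def by auto
  then obtain \<kappa>\<^sub>1 \<kappa>\<^sub>2 A e\<^sub>1 e\<^sub>2 where N: "(N has_derivative A) (at p within S)"
    and e: "norm e\<^sub>1 = 1" "norm e\<^sub>2 = 1" "e\<^sub>1 \<bullet> e\<^sub>2 = 0" and T: "tangent_space S p = span {e\<^sub>1, e\<^sub>2}"
    and \<kappa>: "- A e\<^sub>1 = \<kappa>\<^sub>1 *\<^sub>R e\<^sub>1" "- A e\<^sub>2 = \<kappa>\<^sub>2 *\<^sub>R e\<^sub>2" and H: "H = (\<kappa>\<^sub>1 + \<kappa>\<^sub>2) / 2"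
    unfolding has_mean_curvature_def principal_curvatures_def by blast
  have "p \<notin> surface_boundary S" using bdry p by (auto simp: plane_def)
  then have ip: "interior_point S p"
    using emb p by (auto simp: embedded_surface_def surface_boundary_def)
  have eT: "e\<^sub>1 \<in> tangent_space S p" "e\<^sub>2 \<in> tangent_space S p" by (auto simp: T span_base)
  have n: "norm (N p) = 1" "N p \<bullet> e\<^sub>1 = 0" "N p \<bullet> e\<^sub>2 = 0"
    using nf p eT by (auto simp: unit_normal_field_def)
  have le: "eventually (\<lambda>x. x \<in> S \<longrightarrow> \<phi> x \<le> \<phi> p) (nhds p)"
    using esc by eventually_elim (use order_refl in fastforce)
  note so = touching_second_order[OF ip nf N \<phi> le G]
  define \<mu> where "\<mu> = G p \<bullet> N p"
  have G\<mu>: "G p = \<mu> *\<^sub>R N p"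
    using orthonormal_expansion[OF e(1,2) n(1) e(3) n(2,3), of "G p"] so(1)[OF eT(1)] so(1)[OF eT(2)]
    by (simp add: \<mu>_def)
  \<comment> \<open>If the gradient pointed along \<open>N p\<close>, a short move along
    \<open>N p\<close> would increase \<open>\<phi>\<close>. From there the ray in direction
    \<open>v\<close> misses \<open>S\<close>, and being horizontal it misses both planes, so the
    point would not be enclosed.\<close>
  have "\<mu> \<le> 0"
  proof (rule ccontr)
    assume "\<not> \<mu> \<le> 0"
    then have pos: "\<mu> > 0" by simp
    have "p \<in> S - (plane 0 \<union> plane d)" using p by (auto simp: plane_def)
    with inw obtain \<epsilon> where \<epsilon>: "\<epsilon> > 0"
      "\<And>t. 0 < t \<Longrightarrow> t < \<epsilon> \<Longrightarrow> p + t *\<^sub>R N p \<in> enclosed_region d S"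
      unfolding points_inward_def by blast
    define l where "l = (\<lambda>t::real. p + t *\<^sub>R N p)"
    have dl: "(l has_derivative (\<lambda>t. t *\<^sub>R N p)) (at 0)"
      unfolding l_def by (auto intro!: derivative_eq_intros)
    have "(\<phi> has_derivative (\<lambda>w. G p \<bullet> w)) (at (l 0))"
      using eventually_nhds_x_imp_x[OF \<phi>] by (simp add: l_def)
    from has_derivative_compose[OF dl this]
    have "((\<lambda>t. \<phi> (l t)) has_real_derivative \<mu>) (at 0)"
      by (simp add: has_field_derivative_def \<mu>_def mult_commute_abs)
    from DERIV_pos_inc_right[OF this pos] obtain \<eta> where \<eta>: "\<eta> > 0"
      "\<And>t. 0 < t \<Longrightarrow> t < \<eta> \<Longrightarrow> \<phi> p < \<phi> (l t)" by (auto simp: l_def)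
    have "(l \<longlongrightarrow> p) (at_right 0)"
      unfolding l_def by (auto intro!: tendsto_eq_intros)
    moreover have "eventually (\<lambda>x::real^3. 0 < x$3 \<and> x$3 < d) (nhds p)"
    proof -
      have "open {x::real^3. 0 < x$3 \<and> x$3 < d}"
        by (intro open_Collect_conj open_Collect_less continuous_intros)
      then show ?thesis using p unfolding eventually_nhds by blast
    qed
    ultimately have "eventually (\<lambda>t. (\<phi> (l t) > \<phi> p \<longrightarrow> (\<forall>s\<ge>0. l t + s *\<^sub>R v \<notin> S))
        \<and> 0 < l t $ 3 \<and> l t $ 3 < d) (at_right 0)"
      using eventually_conj[OF esc] by (auto simp: filterlim_iff)
    then obtain b where b: "b > 0" "\<And>t. 0 < t \<Longrightarrow> t < b \<Longrightarrow> (\<phi> (l t) > \<phi> p \<longrightarrow> (\<forall>s\<ge>0. l t + s *\<^sub>R v \<notin> S))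
        \<and> 0 < l t $ 3 \<and> l t $ 3 < d"
      unfolding eventually_at_right_field by blast
    define t where "t = min (min \<epsilon> \<eta>) b / 2"
    have t: "0 < t" "t < \<epsilon>" "t < \<eta>" "t < b" using \<epsilon> \<eta> b by (auto simp: t_def)
    have "l t + s *\<^sub>R v \<notin> S \<union> plane 0 \<union> plane d" if "s \<ge> 0" for s
      using b(2)[OF t(1,4)] \<eta>(2)[OF t(1,3)] that v by (auto simp: plane_def)
    then have "l t \<notin> inside (S \<union> plane 0 \<union> plane d)"
      by (rule not_inside_if_ray_avoids[OF v(1)])
    then show False using \<epsilon>(2)[OF t(1,2)] by (simp add: enclosed_region_def l_def)
  qed
  then have nG: "norm (G p) = - \<mu>" using G\<mu> n by simp
  have \<kappa>': "A e\<^sub>1 \<bullet> e\<^sub>1 = - \<kappa>\<^sub>1" "A e\<^sub>2 \<bullet> e\<^sub>2 = - \<kappa>\<^sub>2"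
    using arg_cong[OF \<kappa>(1), of "\<lambda>x. x \<bullet> e\<^sub>1"] arg_cong[OF \<kappa>(2), of "\<lambda>x. x \<bullet> e\<^sub>2"] e
    by (simp_all add: dot_square_norm)
  \<comment> \<open>Each direction contributes at most \<open>- \<mu>\<close> times its principal
    curvature, and \<open>- \<mu>\<close> is the norm of the gradient.\<close>
  have "B e\<^sub>1 \<bullet> e\<^sub>1 + B e\<^sub>2 \<bullet> e\<^sub>2 \<le> 2 * H * norm (G p)"
    using so(2)[OF eT(1) G\<mu>] so(2)[OF eT(2) G\<mu>] by (simp add: \<kappa>' nG H algebra_simps)
  moreover have "G p = - norm (G p) *\<^sub>R N p" using G\<mu> nG by simp
  ultimately show ?thesis using that[OF e(1,2) n(1) e(3) n(2,3)] by blast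
qed


section \<open>Cylinders and tori as barriers\<close>

text \<open>The barrier is a level set of \<open>\<phi>\<close>, half the squared distance to the
  axis. Its Hessian \<open>B\<close> projects onto the span of \<open>a\<close> and
  \<open>b\<close>, with trace 2; the normal \<open>n\<close> lies in that span and takes up 1,
  which leaves trace 1 on the tangent plane.\<close>

lemma cylinder_comparison:
  fixes a b v :: "real^3"
  assumes cmc: "cmc_surface_in_cylinder r d S N H" and p: "p \<in> S" "0 < p$3" "p$3 < d"
    and ab: "norm a = 1" "norm b = 1" "a \<bullet> b = 0"
    and \<rho>: "\<rho> > 0" "(p \<bullet> a - \<alpha>)\<^sup>2 + (p \<bullet> b - \<beta>)\<^sup>2 = \<rho>\<^sup>2"
    and v: "v \<noteq> 0" "v$3 = 0"
    and esc: "eventually (\<lambda>x. (x \<bullet> a - \<alpha>)\<^sup>2 + (x \<bullet> b - \<beta>)\<^sup>2 > \<rho>\<^sup>2 \<longrightarrow>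
                 (\<forall>s\<ge>0. x + s *\<^sub>R v \<notin> S)) (nhds p)"
  shows "1 \<le> 2 * H * \<rho>"
proof -
  define \<phi> where "\<phi> = (\<lambda>x. 1 / 2 * ((x \<bullet> a - \<alpha>)\<^sup>2 + (x \<bullet> b - \<beta>)\<^sup>2))"
  define G where "G = (\<lambda>x. (x \<bullet> a - \<alpha>) *\<^sub>R a + (x \<bullet> b - \<beta>) *\<^sub>R b)"
  define B where "B = (\<lambda>w. (w \<bullet> a) *\<^sub>R a + (w \<bullet> b) *\<^sub>R b)"
  have sq: "a \<bullet> a = 1" "b \<bullet> b = 1" "b \<bullet> a = 0"
    using ab by (auto simp: dot_square_norm inner_commute)
  have "(\<phi> has_derivative (\<lambda>w. G x \<bullet> w)) (at x)" for x
    unfolding \<phi>_def G_def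
    by (auto intro!: derivative_eq_intros simp: inner_add_left inner_commute algebra_simps fun_eq_iff)
      (simp add: field_simps)
  then have \<phi>: "eventually (\<lambda>x. (\<phi> has_derivative (\<lambda>w. G x \<bullet> w)) (at x)) (nhds p)" by simp
  have G: "(G has_derivative B) (at p)"
    unfolding G_def B_def by (auto intro!: derivative_eq_intros)
  have esc': "eventually (\<lambda>x. \<phi> x > \<phi> p \<longrightarrow> (\<forall>s\<ge>0. x + s *\<^sub>R v \<notin> S)) (nhds p)"
    using esc by (simp add: \<phi>_def \<rho>)
  have "(norm (G p))\<^sup>2 = (p \<bullet> a - \<alpha>)\<^sup>2 + (p \<bullet> b - \<beta>)\<^sup>2"
    unfolding power2_norm_eq_inner
    by (auto simp: G_def inner_add_left inner_add_right sq ab power2_eq_square algebra_simps)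
  then have nG: "norm (G p) = \<rho>" using \<rho> sq by simp
  obtain e\<^sub>1 e\<^sub>2 n where e: "norm e\<^sub>1 = 1" "norm e\<^sub>2 = 1" "norm n = 1"
    "e\<^sub>1 \<bullet> e\<^sub>2 = 0" "n \<bullet> e\<^sub>1 = 0" "n \<bullet> e\<^sub>2 = 0" and n: "G p = - norm (G p) *\<^sub>R n"
    and le: "B e\<^sub>1 \<bullet> e\<^sub>1 + B e\<^sub>2 \<bullet> e\<^sub>2 \<le> 2 * H * norm (G p)"
    using mean_curvature_comparison[OF cmc p \<phi> G v esc'] by metis
  have dn: "\<rho> * (y \<bullet> n) = - (y \<bullet> G p)" for y
    using arg_cong[OF n, of "\<lambda>x. y \<bullet> x"] by (simp add: nG)
  have "\<rho> * (a \<bullet> n) = - (p \<bullet> a - \<alpha>)" "\<rho> * (b \<bullet> n) = - (p \<bullet> b - \<beta>)"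
    unfolding dn by (simp_all add: G_def inner_add_right sq ab)
  then have "\<rho>\<^sup>2 * ((a \<bullet> n)\<^sup>2 + (b \<bullet> n)\<^sup>2) = (p \<bullet> a - \<alpha>)\<^sup>2 + (p \<bullet> b - \<beta>)\<^sup>2"
    by (auto simp: distrib_left power2_commute simp flip: power_mult_distrib)
  then have "(a \<bullet> n)\<^sup>2 + (b \<bullet> n)\<^sup>2 = 1" using \<rho> sq by simp
  moreover have "(a \<bullet> e\<^sub>1)\<^sup>2 + (a \<bullet> e\<^sub>2)\<^sup>2 + (a \<bullet> n)\<^sup>2 = 1" "(b \<bullet> e\<^sub>1)\<^sup>2 + (b \<bullet> e\<^sub>2)\<^sup>2 + (b \<bullet> n)\<^sup>2 = 1"
    using orthonormal_parseval[OF e, of a] orthonormal_parseval[OF e, of b] sq by auto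
  ultimately have "((a \<bullet> e\<^sub>1)\<^sup>2 + (a \<bullet> e\<^sub>2)\<^sup>2) + ((b \<bullet> e\<^sub>1)\<^sup>2 + (b \<bullet> e\<^sub>2)\<^sup>2) = 1" by linarith
  moreover have "B e\<^sub>1 \<bullet> e\<^sub>1 + B e\<^sub>2 \<bullet> e\<^sub>2 =
      ((a \<bullet> e\<^sub>1)\<^sup>2 + (a \<bullet> e\<^sub>2)\<^sup>2) + ((b \<bullet> e\<^sub>1)\<^sup>2 + (b \<bullet> e\<^sub>2)\<^sup>2)"
    by (simp add: B_def inner_add_left inner_commute power2_eq_square algebra_simps)
  ultimately have "B e\<^sub>1 \<bullet> e\<^sub>1 + B e\<^sub>2 \<bullet> e\<^sub>2 = 1" by simp
  then show ?thesis using le nG by simp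
qed

text \<open>Here \<open>s\<close> is the distance to the axis of revolution and
  \<open>\<phi>\<close> is half the squared distance to the core circle of radius \<open>R\<close>.
  The torus has principal curvatures \<open>1 / \<rho>\<close> along the meridian and
  \<open>(1 - R / s p) / \<rho>\<close> along the parallel, so \<open>2 - R / s p\<close> is
  \<open>\<rho>\<close> times their sum.\<close>

lemma torus_comparison:
  fixes a b c v :: "real^3" and \<alpha> \<gamma> :: real
  defines "s \<equiv> \<lambda>x. sqrt ((x \<bullet> a - \<alpha>)\<^sup>2 + (x \<bullet> c - \<gamma>)\<^sup>2)"
  assumes cmc: "cmc_surface_in_cylinder r d S N H" and p: "p \<in> S" "0 < p$3" "p$3 < d"
    and abc: "norm a = 1" "norm b = 1" "norm c = 1" "a \<bullet> b = 0" "a \<bullet> c = 0" "b \<bullet> c = 0"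
    and \<rho>: "\<rho> > 0" "s p > 0" "(p \<bullet> b)\<^sup>2 + (s p - R)\<^sup>2 = \<rho>\<^sup>2"
    and v: "v \<noteq> 0" "v$3 = 0"
    and esc: "eventually (\<lambda>x. (x \<bullet> b)\<^sup>2 + (s x - R)\<^sup>2 > \<rho>\<^sup>2 \<longrightarrow>
                 (\<forall>t\<ge>0. x + t *\<^sub>R v \<notin> S)) (nhds p)"
  shows "2 - R / s p \<le> 2 * H * \<rho>"
proof -
  define \<phi> where "\<phi> = (\<lambda>x. 1 / 2 * ((x \<bullet> b)\<^sup>2 + (s x - R)\<^sup>2))"
  define m where "m = (\<lambda>x. (x \<bullet> a - \<alpha>) *\<^sub>R a + (x \<bullet> c - \<gamma>) *\<^sub>R c)"
  define G where "G = (\<lambda>x. (x \<bullet> b) *\<^sub>R b + (1 - R / s x) *\<^sub>R m x)"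
  \<comment> \<open>The derivative of \<open>G\<close> at \<open>p\<close>; the last term comes from
    differentiating the factor \<open>1 - R / s x\<close>.\<close>
  define B where "B = (\<lambda>w. (w \<bullet> b) *\<^sub>R b + (1 - R / s p) *\<^sub>R ((w \<bullet> a) *\<^sub>R a + (w \<bullet> c) *\<^sub>R c)
                        + (R / s p ^ 3 * (m p \<bullet> w)) *\<^sub>R m p)"
  have sq: "a \<bullet> a = 1" "b \<bullet> b = 1" "c \<bullet> c = 1" "b \<bullet> a = 0" "c \<bullet> a = 0" "c \<bullet> b = 0"
    using abc by (auto simp: dot_square_norm inner_commute)
  have mm: "m x \<bullet> m x = (s x)\<^sup>2" for x
    unfolding m_def s_def using sq abc by (simp add: inner_add_left inner_add_right power2_eq_square)
  have ds: "(s has_derivative (\<lambda>w. (m x \<bullet> w) / s x)) (at x)" if "s x > 0" for x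
  proof -
    have "(x \<bullet> a - \<alpha>)\<^sup>2 + (x \<bullet> c - \<gamma>)\<^sup>2 > 0" using that by (simp add: s_def)
    moreover have "((\<lambda>x. (x \<bullet> a - \<alpha>)\<^sup>2 + (x \<bullet> c - \<gamma>)\<^sup>2) has_derivative (\<lambda>w. 2 * (m x \<bullet> w))) (at x)"
      unfolding m_def
      by (auto intro!: derivative_eq_intros simp: inner_add_left inner_commute algebra_simps fun_eq_iff)
    ultimately have "(s has_derivative (\<lambda>w. 2 * (m x \<bullet> w) * (inverse (s x) / 2))) (at x)"
      unfolding s_def by (intro DERIV_compose_FDERIV[OF DERIV_real_sqrt])
    then show ?thesis by (simp add: field_simps)
  qed
  have "(\<phi> has_derivative (\<lambda>w. G x \<bullet> w)) (at x)" if "s x > 0" for x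
    unfolding \<phi>_def G_def using that
    by (auto intro!: derivative_eq_intros ds simp: fun_eq_iff)
      (simp add: inner_add_left inner_add_right inner_commute[of _ b], simp add: field_simps)
  moreover have "eventually (\<lambda>x. s x > 0) (nhds p)"
  proof -
    have "open {x. s x > 0}"
      unfolding s_def by (intro open_Collect_less continuous_intros)
    then show ?thesis using \<rho> unfolding eventually_nhds by blast
  qed
  ultimately have \<phi>: "eventually (\<lambda>x. (\<phi> has_derivative (\<lambda>w. G x \<bullet> w)) (at x)) (nhds p)"
    by (auto elim: eventually_mono)
  have dm: "(m has_derivative (\<lambda>w. (w \<bullet> a) *\<^sub>R a + (w \<bullet> c) *\<^sub>R c)) (at p)"
    unfolding m_def by (auto intro!: derivative_eq_intros)
  have "((\<lambda>y. 1 - R / y) has_real_derivative R / (s p)\<^sup>2) (at (s p))"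
    using \<rho>(2) by (auto intro!: derivative_eq_intros simp: power2_eq_square)
  from DERIV_compose_FDERIV[OF this ds[OF \<rho>(2)]]
  have "((\<lambda>x. 1 - R / s x) has_derivative (\<lambda>w. R / s p ^ 3 * (m p \<bullet> w))) (at p)"
    by (simp add: power2_eq_square power3_eq_cube mult.commute)
  note dsm = has_derivative_scaleR[OF this dm]
  have "((\<lambda>x. (x \<bullet> b) *\<^sub>R b) has_derivative (\<lambda>x. (x \<bullet> b) *\<^sub>R b)) (at p)"
    by (auto intro!: derivative_intros)
  from has_derivative_add[OF this dsm] have G: "(G has_derivative B) (at p)"
    unfolding G_def B_def by (simp add: add.assoc)
  have esc': "eventually (\<lambda>x. \<phi> x > \<phi> p \<longrightarrow> (\<forall>t\<ge>0. x + t *\<^sub>R v \<notin> S)) (nhds p)"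
    using esc by (simp add: \<phi>_def \<rho>)
  define k where "k = 1 - R / s p"
  have ks: "k * s p = s p - R" using \<rho>(2) by (simp add: k_def field_simps)
  have mb: "m p \<bullet> b = 0" "b \<bullet> m p = 0" by (simp_all add: m_def sq abc inner_add_left inner_add_right)
  have "(norm (G p))\<^sup>2 = (p \<bullet> b)\<^sup>2 + k\<^sup>2 * (m p \<bullet> m p)"
    unfolding power2_norm_eq_inner
    by (simp add: G_def inner_add_left inner_add_right sq mb power2_eq_square flip: k_def)
  then have "(norm (G p))\<^sup>2 = \<rho>\<^sup>2"
    using \<rho>(3) ks by (simp add: mm flip: power_mult_distrib)
  then have nG: "norm (G p) = \<rho>" using \<rho> by simp
  obtain e\<^sub>1 e\<^sub>2 n where e: "norm e\<^sub>1 = 1" "norm e\<^sub>2 = 1" "norm n = 1"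
    "e\<^sub>1 \<bullet> e\<^sub>2 = 0" "n \<bullet> e\<^sub>1 = 0" "n \<bullet> e\<^sub>2 = 0" and n: "G p = - norm (G p) *\<^sub>R n"
    and le: "B e\<^sub>1 \<bullet> e\<^sub>1 + B e\<^sub>2 \<bullet> e\<^sub>2 \<le> 2 * H * norm (G p)"
    using mean_curvature_comparison[OF cmc p \<phi> G v esc'] by metis
  have dn: "y \<bullet> n = - (y \<bullet> G p) / \<rho>" for y
    using arg_cong[OF n, of "\<lambda>x. y \<bullet> x"] \<rho> by (simp add: nG field_simps)
  have an: "a \<bullet> n = - (k * (p \<bullet> a - \<alpha>)) / \<rho>" and bn: "b \<bullet> n = - (p \<bullet> b) / \<rho>"
    and cn: "c \<bullet> n = - (k * (p \<bullet> c - \<gamma>)) / \<rho>" and mn: "m p \<bullet> n = - (k * (s p)\<^sup>2) / \<rho>"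
    unfolding dn by (simp_all add: G_def inner_add_right mb mm flip: k_def)
      (simp_all add: m_def inner_add_right sq abc)
  have pars: "(y \<bullet> e\<^sub>1)\<^sup>2 + (y \<bullet> e\<^sub>2)\<^sup>2 = y \<bullet> y - (y \<bullet> n)\<^sup>2" for y
    using orthonormal_parseval[OF e, of y] by simp
  have Bw: "B w \<bullet> w = (b \<bullet> w)\<^sup>2 + k * ((a \<bullet> w)\<^sup>2 + (c \<bullet> w)\<^sup>2) + R / s p ^ 3 * (m p \<bullet> w)\<^sup>2" for w
    by (simp add: B_def inner_add_left power2_eq_square inner_commute[of w a] inner_commute[of w b]
        inner_commute[of w c] flip: k_def)
  \<comment> \<open>The trace is grouped by the fixed vectors \<open>a\<close>, \<open>b\<close>,
    \<open>c\<close> and \<open>m p\<close>, so that \<open>pars\<close> applies to each of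
    them.\<close>
  have "B e\<^sub>1 \<bullet> e\<^sub>1 + B e\<^sub>2 \<bullet> e\<^sub>2 = ((b \<bullet> e\<^sub>1)\<^sup>2 + (b \<bullet> e\<^sub>2)\<^sup>2) +
      k * (((a \<bullet> e\<^sub>1)\<^sup>2 + (a \<bullet> e\<^sub>2)\<^sup>2) + ((c \<bullet> e\<^sub>1)\<^sup>2 + (c \<bullet> e\<^sub>2)\<^sup>2)) +
      R / s p ^ 3 * ((m p \<bullet> e\<^sub>1)\<^sup>2 + (m p \<bullet> e\<^sub>2)\<^sup>2)"
    unfolding Bw by (simp add: algebra_simps add_divide_distrib)
  also have "\<dots> = (1 - (b \<bullet> n)\<^sup>2) + k * ((1 - (a \<bullet> n)\<^sup>2) + (1 - (c \<bullet> n)\<^sup>2)) +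
      R / s p ^ 3 * ((s p)\<^sup>2 - (m p \<bullet> n)\<^sup>2)"
    unfolding pars by (simp add: sq mm)
  also have "\<dots> = 2 - R / s p"
  proof -
    have k2: "k\<^sup>2 * (s p)\<^sup>2 = \<rho>\<^sup>2 - (p \<bullet> b)\<^sup>2" using ks \<rho>(3) by (simp flip: power_mult_distrib)
    have s2: "(p \<bullet> a - \<alpha>)\<^sup>2 + (p \<bullet> c - \<gamma>)\<^sup>2 = (s p)\<^sup>2" by (simp add: s_def)
    have "(a \<bullet> n)\<^sup>2 + (c \<bullet> n)\<^sup>2 = k\<^sup>2 * ((p \<bullet> a - \<alpha>)\<^sup>2 + (p \<bullet> c - \<gamma>)\<^sup>2) / \<rho>\<^sup>2"
      by (simp add: an cn power_divide power_mult_distrib add_divide_distrib distrib_left)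
    then have ac: "(a \<bullet> n)\<^sup>2 + (c \<bullet> n)\<^sup>2 = 1 - (b \<bullet> n)\<^sup>2"
      using \<rho> k2 by (simp add: s2 bn power_divide diff_divide_distrib)
    have "(m p \<bullet> n)\<^sup>2 = (k\<^sup>2 * (s p)\<^sup>2) * (s p)\<^sup>2 / \<rho>\<^sup>2"
      by (simp add: mn power_divide power_mult_distrib power2_eq_square)
    then have m2: "(m p \<bullet> n)\<^sup>2 = (s p)\<^sup>2 * (1 - (b \<bullet> n)\<^sup>2)"
      using \<rho> unfolding k2 by (simp add: bn power_divide field_simps)
    have 1: "R / s p ^ 3 * ((s p)\<^sup>2 - (m p \<bullet> n)\<^sup>2) = R / s p * (b \<bullet> n)\<^sup>2"
      using \<rho>(2) unfolding m2 by (simp add: field_simps power3_eq_cube power2_eq_square)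
    have 2: "(1 - (a \<bullet> n)\<^sup>2) + (1 - (c \<bullet> n)\<^sup>2) = 1 + (b \<bullet> n)\<^sup>2" using ac by simp
    show ?thesis unfolding 1 2 by (simp add: k_def algebra_simps)
  qed
  finally show ?thesis using le nG by simp
qed


section \<open>Sliding the half-torus until first contact\<close>

text \<open>Provides the direction \<open>a\<close> along which the torus moves: the horizontal part
  of \<open>q\<close> is a nonnegative multiple of it.\<close>

lemma horizontal_frame:
  fixes q :: "real^3"
  obtains a b :: "real^3" where "norm a = 1" "norm b = 1" "a \<bullet> b = 0" "a$3 = 0" "b$3 = 0"
    "q \<bullet> b = 0" "q \<bullet> a \<ge> 0" "\<And>x. (x \<bullet> a)\<^sup>2 + (x \<bullet> b)\<^sup>2 = (x$1)\<^sup>2 + (x$2)\<^sup>2"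
proof -
  obtain \<rho> t where q: "q$1 = \<rho> * cos t" "q$2 = \<rho> * sin t" using polar_Ex by blast
  \<comment> \<open>The polar radius from \<open>polar_Ex\<close> may be negative;
    \<open>\<sigma>\<close> reverses the direction in that case.\<close>
  define \<sigma> :: real where "\<sigma> = (if \<rho> \<ge> 0 then 1 else - 1)"
  define \<alpha> \<beta> where "\<alpha> = \<sigma> * cos t" and "\<beta> = \<sigma> * sin t"
  define a b :: "real^3" where "a = vector [\<alpha>, \<beta>, 0]" and "b = vector [- \<beta>, \<alpha>, 0]"
  have \<sigma>: "\<sigma>\<^sup>2 = 1" "\<rho> * \<sigma> = \<bar>\<rho>\<bar>" by (auto simp: \<sigma>_def)
  have \<alpha>\<beta>: "\<alpha>\<^sup>2 + \<beta>\<^sup>2 = 1"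
    by (simp add: \<alpha>_def \<beta>_def power_mult_distrib \<sigma> add.commute)
  have xa: "x \<bullet> a = x$1 * \<alpha> + x$2 * \<beta>" and xb: "x \<bullet> b = x$2 * \<alpha> - x$1 * \<beta>" for x
    by (simp_all add: a_def b_def inner_vec_def sum_3)
  have aa: "a \<bullet> a = 1" and bb: "b \<bullet> b = 1"
    using \<alpha>\<beta> by (simp_all add: a_def b_def inner_vec_def sum_3 power2_eq_square)
  show ?thesis
  proof (rule that)
    show "norm a = 1" "norm b = 1" using aa bb by (simp_all add: norm_eq_sqrt_inner)
    show "a \<bullet> b = 0" unfolding xb by (simp add: a_def)
    show "a $ 3 = 0" "b $ 3 = 0" by (simp_all add: a_def b_def)
    show "q \<bullet> b = 0" unfolding xb by (simp add: q \<alpha>_def \<beta>_def)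
    have "q \<bullet> a = (\<rho> * \<sigma>) * (cos t)\<^sup>2 + (\<rho> * \<sigma>) * (sin t)\<^sup>2"
      unfolding xa by (simp add: q \<alpha>_def \<beta>_def power2_eq_square algebra_simps)
    then show "q \<bullet> a \<ge> 0" by (simp add: \<sigma>)
    fix x :: "real^3"
    have "(x \<bullet> a)\<^sup>2 + (x \<bullet> b)\<^sup>2 = ((x$1)\<^sup>2 + (x$2)\<^sup>2) * (\<alpha>\<^sup>2 + \<beta>\<^sup>2)"
      unfolding xa xb by (simp add: power2_eq_square algebra_simps)
    then show "(x \<bullet> a)\<^sup>2 + (x \<bullet> b)\<^sup>2 = (x$1)\<^sup>2 + (x$2)\<^sup>2" by (simp add: \<alpha>\<beta>)
  qed
qed

text \<open>\<open>S\<close> touches the cylinder of radius \<open>r\<close> from inside. The escape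
  direction is the horizontal part of \<open>p\<close>: near \<open>p\<close>, moving along it never
  decreases the distance to the axis, so a ray that starts outside the wall stays outside.\<close>

lemma cmc_surface_touching_wall:
  assumes cmc: "cmc_surface_in_cylinder r d S N H" and "r > 0"
    and p: "p \<in> S" "0 < p$3" "p$3 < d" "(p$1)\<^sup>2 + (p$2)\<^sup>2 = r\<^sup>2"
  shows "1 \<le> 2 * H * r"
proof -
  have S: "S \<subseteq> solid_cylinder r d" using cmc by (simp add: cmc_surface_in_cylinder_def)
  define v :: "real^3" where "v = vector [p$1, p$2, 0]"
  have xv: "x \<bullet> v = x$1 * p$1 + x$2 * p$2" for x
    by (simp add: v_def inner_vec_def sum_3)
  have pv: "p \<bullet> v = r\<^sup>2" using p by (simp add: xv power2_eq_square)
  have "v \<noteq> 0" using pv \<open>r > 0\<close> by auto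
  have "open {x. x \<bullet> v > 0}" by (intro open_Collect_less continuous_intros)
  then have "eventually (\<lambda>x. x \<bullet> v > 0) (nhds p)"
    using pv \<open>r > 0\<close> unfolding eventually_nhds by fastforce
  then have "eventually (\<lambda>x. (x \<bullet> axis 1 1 - 0)\<^sup>2 + (x \<bullet> axis 2 1 - 0)\<^sup>2 > r\<^sup>2 \<longrightarrow>
                 (\<forall>s\<ge>0. x + s *\<^sub>R v \<notin> S)) (nhds p)"
  proof eventually_elim
    case (elim x)
    show ?case
    proof (intro impI allI notI)
      fix s :: real
      assume x: "r\<^sup>2 < (x \<bullet> axis 1 1 - 0)\<^sup>2 + (x \<bullet> axis 2 1 - 0)\<^sup>2" and s: "0 \<le> s" "x + s *\<^sub>R v \<in> S"
      have "((x + s *\<^sub>R v)$1)\<^sup>2 + ((x + s *\<^sub>R v)$2)\<^sup>2 =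
          ((x$1)\<^sup>2 + (x$2)\<^sup>2) + 2 * s * (x \<bullet> v) + s\<^sup>2 * ((p$1)\<^sup>2 + (p$2)\<^sup>2)"
        unfolding xv by (simp add: v_def power2_eq_square algebra_simps)
      also have "\<dots> > r\<^sup>2"
      proof -
        have "2 * s * (x \<bullet> v) \<ge> 0" "s\<^sup>2 * ((p$1)\<^sup>2 + (p$2)\<^sup>2) \<ge> 0" using elim s(1) by simp_all
        moreover have "r\<^sup>2 < (x$1)\<^sup>2 + (x$2)\<^sup>2" using x by (simp add: inner_axis)
        ultimately show ?thesis by linarith
      qed
      finally show False using s(2) S by (auto simp: solid_cylinder_def)
    qed
  qed
  then show ?thesis
    by (intro cylinder_comparison[OF cmc p(1-3), where a="axis 1 1" and b="axis 2 1" and \<alpha>=0 and \<beta>=0 and v=v])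
      (use p \<open>r > 0\<close> \<open>v \<noteq> 0\<close> in \<open>auto simp: inner_axis v_def axis_nth[of 1 1]\<close>, simp add: axis_def)
qed

text \<open>The inner half of the torus stays at distance at least \<open>m\<close> from its axis,
  so \<open>R / s p\<close> is at most \<open>1 + r / m\<close> at the contact point. The strict
  bound on \<open>m\<close> rules out contact at heights 0 and \<open>d\<close>.\<close>

lemma cmc_surface_mean_curvature_ge:
  assumes cmc: "cmc_surface_in_cylinder r d S N H" and r: "0 < r" "r < d / 2"
    and m: "0 < m" "8 * r * m < d\<^sup>2 - 4 * r\<^sup>2"
  shows "1 / (2 * r) - 1 / (2 * m) \<le> H"
\<comment> \<open>Touching the wall strictly between the planes gives more than is claimed. In the
  other case the contact point is off the edge of the half-tube, where the torus is smooth and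
  \<open>torus_comparison\<close> applies.\<close>
proof (cases "\<exists>p\<in>S. 0 < p$3 \<and> p$3 < d \<and> (p$1)\<^sup>2 + (p$2)\<^sup>2 = r\<^sup>2")
  case True
  then have "1 \<le> 2 * H * r" using cmc_surface_touching_wall[OF cmc r(1)] by blast
  then have "1 / (2 * r) \<le> H" using r by (simp add: field_simps)
  then show ?thesis using m by (smt (verit) divide_pos_pos)
next
  case no_wall: False
  have S: "S \<subseteq> solid_cylinder r d" and comp: "compact S" and conn: "connected S"
    and "surface_boundary S \<inter> plane 0 \<noteq> {}" "surface_boundary S \<inter> plane d \<noteq> {}"
    using cmc by (auto simp: cmc_surface_in_cylinder_def)
  then obtain x y where "x \<in> S" "x$3 = 0" "y \<in> S" "y$3 = d"
    by (auto simp: plane_def surface_boundary_def boundary_point_def)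
  \<comment> \<open>Connectedness enters here: \<open>S\<close> meets both planes, hence also the
    middle height. This point keeps the maximum of \<open>h\<close> at least
    \<open>m\<close>.\<close>
  then obtain q where q: "q \<in> S" "q$3 = d / 2"
    using connected_ivt_component_cart[OF conn, of x y 3 "d / 2"] r by auto
  obtain a b where ab: "norm a = 1" "norm b = 1" "a \<bullet> b = 0" "a$3 = 0" "b$3 = 0"
    and qab: "q \<bullet> b = 0" "q \<bullet> a \<ge> 0" and hor: "\<And>x. (x \<bullet> a)\<^sup>2 + (x \<bullet> b)\<^sup>2 = (x$1)\<^sup>2 + (x$2)\<^sup>2"
    using horizontal_frame[of q] by metis
  have aa: "a \<bullet> a = 1" "b \<bullet> a = 0" using ab by (simp_all add: dot_square_norm inner_commute)
  have inC: "(x \<bullet> a)\<^sup>2 + (x \<bullet> b)\<^sup>2 \<le> r\<^sup>2" "0 \<le> x$3" "x$3 \<le> d" if "x \<in> S" for x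
    using S that by (auto simp: hor solid_cylinder_def)
  \<comment> \<open>The translate of the half-torus through \<open>x\<close> has its axis of revolution at \<open>a\<close>-coordinate \<open>h x\<close>, so
    first contact is the maximum of \<open>h\<close>. Where \<open>rad\<close> is negative no translate passes through \<open>x\<close> and
    the value of \<open>sqrt\<close> is junk.\<close>
  define R where "R = m + r"
  \<comment> \<open>At the \<open>b\<close>-coordinate of \<open>x\<close>, the inner half of the
    tube is at distance \<open>R - u x\<close> from the axis of revolution, which has height
    \<open>d / 2\<close>. Solving for the \<open>a\<close>-coordinate of that axis gives
    \<open>h x\<close> as the larger root.\<close>
  define u where "u = (\<lambda>x. sqrt (r\<^sup>2 - (x \<bullet> b)\<^sup>2))"
  define rad where "rad = (\<lambda>x. (R - u x)\<^sup>2 - (x$3 - d / 2)\<^sup>2)"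
  define h where "h = (\<lambda>x. x \<bullet> a + sqrt (rad x))"
  have u: "0 \<le> u x" "u x \<le> r" "(u x)\<^sup>2 = r\<^sup>2 - (x \<bullet> b)\<^sup>2" "\<bar>x \<bullet> a\<bar> \<le> u x" if "x \<in> S" for x
  proof -
    have le: "(x \<bullet> b)\<^sup>2 \<le> r\<^sup>2" "(x \<bullet> a)\<^sup>2 \<le> r\<^sup>2 - (x \<bullet> b)\<^sup>2"
      using inC(1)[OF that] zero_le_power2[of "x \<bullet> a"] by linarith+
    then show "0 \<le> u x" "(u x)\<^sup>2 = r\<^sup>2 - (x \<bullet> b)\<^sup>2" by (simp_all add: u_def)
    show "\<bar>x \<bullet> a\<bar> \<le> u x" unfolding u_def using le(2) by (rule real_le_rsqrt[of "\<bar>_\<bar>", unfolded power2_abs])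
    show "u x \<le> r" unfolding u_def using r by (intro real_le_lsqrt) auto
  qed
  have cont: "continuous_on A rad" "continuous_on A h" for A
    unfolding rad_def h_def u_def by (intro continuous_intros)+
  define S\<^sub>0 where "S\<^sub>0 = S \<inter> {x. 0 \<le> rad x}"
  have "closed {x. 0 \<le> rad x}" by (intro closed_Collect_le continuous_intros cont)
  then have "compact S\<^sub>0" unfolding S\<^sub>0_def using comp by (rule compact_Int_closed[rotated])
  \<comment> \<open>Since \<open>q \<bullet> b = 0\<close>, the radius is \<open>R - r = m\<close>,
    and the height term vanishes.\<close>
  have radq: "rad q = m\<^sup>2" using r by (simp add: rad_def u_def qab q R_def)
  then have q0: "q \<in> S\<^sub>0" using q by (simp add: S\<^sub>0_def)
  then obtain p where p0: "p \<in> S\<^sub>0" and max: "\<And>x. x \<in> S\<^sub>0 \<Longrightarrow> h x \<le> h p"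
    using continuous_attains_sup[OF \<open>compact S\<^sub>0\<close> _ cont(2)] by blast
  then have p: "p \<in> S" "rad p \<ge> 0" by (auto simp: S\<^sub>0_def)
  define T where "T = h p"
  have "h q \<ge> m" using qab m by (simp add: h_def radq)
  then have T: "T \<ge> m" using max[OF q0] by (simp add: T_def)
  have up: "0 \<le> u p" "u p \<le> r" "(u p)\<^sup>2 = r\<^sup>2 - (p \<bullet> b)\<^sup>2" "\<bar>p \<bullet> a\<bar> \<le> u p" by (fact u[OF p(1)])+
  \<comment> \<open>On the planes the bound on \<open>m\<close> gives
    \<open>sqrt (rad p) < m - u p\<close>. As \<open>p \<bullet> a \<le> u p\<close>, this forces
    \<open>h p < m\<close>, contrary to \<open>T \<ge> m\<close>.\<close>
  have p3: "0 < p$3 \<and> p$3 < d"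
  proof (rule ccontr)
    assume "\<not> (0 < p$3 \<and> p$3 < d)"
    then have "p$3 = 0 \<or> p$3 = d" using inC[OF p(1)] by linarith
    then have e: "(p$3 - d / 2)\<^sup>2 = (d / 2)\<^sup>2" by (auto simp: power2_eq_square)
    have "(d / 2)\<^sup>2 \<le> (R - u p)\<^sup>2" using p(2) by (simp add: rad_def e)
    then have "d / 2 \<le> R - u p"
      by (rule power2_le_imp_le) (use up(2) m(1) in \<open>simp add: R_def\<close>)
    then have um: "u p < m" using r by (simp add: R_def)
    have "0 \<le> r * u p" using r up by simp
    moreover have "(m - u p)\<^sup>2 - rad p = d\<^sup>2 / 4 - r\<^sup>2 - 2 * r * m + 2 * (r * u p)"
      unfolding rad_def e R_def by (simp add: power2_eq_square field_simps)
    ultimately have "rad p < (m - u p)\<^sup>2" using m(2) by linarith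
    then have "sqrt (rad p) < m - u p" using um by (simp add: real_less_lsqrt p(2))
    then have "T < m" using up by (simp add: T_def h_def)
    then show False using T by simp
  qed
  have pr: "(p \<bullet> b)\<^sup>2 < r\<^sup>2"
  proof -
    have "(p \<bullet> a)\<^sup>2 + (p \<bullet> b)\<^sup>2 \<noteq> r\<^sup>2" using no_wall p(1) p3 by (auto simp: hor)
    then show ?thesis using inC(1)[OF p(1)] zero_le_power2[of "p \<bullet> a"] by linarith
  qed
  define s where "s = (\<lambda>x. sqrt ((x \<bullet> a - T)\<^sup>2 + (x \<bullet> axis 3 1 - d / 2)\<^sup>2))"
  have "(p \<bullet> a - T)\<^sup>2 = rad p" using p(2) by (simp add: T_def h_def)
  then have "s p = sqrt ((R - u p)\<^sup>2)" by (simp add: s_def rad_def inner_axis)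
  then have sp: "s p = R - u p" using up m by (simp add: R_def)
  have spm: "s p \<ge> m" using up sp by (simp add: R_def)
  have u0: "u p > 0" using pr by (simp add: u_def)
  have open1: "open {x. (x \<bullet> b)\<^sup>2 < r\<^sup>2 \<and> s x < R}"
    unfolding s_def by (intro open_Collect_conj open_Collect_less continuous_intros)
  have "eventually (\<lambda>x. (x \<bullet> b)\<^sup>2 < r\<^sup>2 \<and> s x < R) (nhds p)"
    unfolding eventually_nhds by (rule exI[of _ "{x. (x \<bullet> b)\<^sup>2 < r\<^sup>2 \<and> s x < R}"]) (use open1 pr sp u0 in auto)
  \<comment> \<open>A point near \<open>p\<close> outside the tube still has \<open>s x < R\<close>,
    so it lies on the inner side, and there \<open>x \<bullet> a + sqrt (rad x) > T\<close>. Moving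
    along \<open>a\<close> keeps \<open>rad\<close> fixed and does not lower \<open>h\<close>, so
    reaching \<open>S\<close> would violate the maximality of \<open>T\<close>.\<close>
  then have esc: "eventually (\<lambda>x. (x \<bullet> b)\<^sup>2 + (s x - R)\<^sup>2 > r\<^sup>2 \<longrightarrow> (\<forall>t\<ge>0. x + t *\<^sub>R a \<notin> S)) (nhds p)"
  proof eventually_elim
    case (elim x)
    show ?case
    proof (intro impI allI notI)
      fix t :: real
      assume x: "r\<^sup>2 < (x \<bullet> b)\<^sup>2 + (s x - R)\<^sup>2" and t: "0 \<le> t" "x + t *\<^sub>R a \<in> S"
      have "(u x)\<^sup>2 < (R - s x)\<^sup>2" using x elim by (simp add: u_def power2_commute)
      then have "u x < R - s x" by (rule power2_less_imp_less) (use elim in simp)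
      then have "s x < R - u x" by simp
      then have "(s x)\<^sup>2 < (R - u x)\<^sup>2" by (rule power_strict_mono) (simp_all add: s_def)
      then have lt: "(T - x \<bullet> a)\<^sup>2 < rad x"
        by (simp add: s_def rad_def inner_axis power2_commute)
      have "rad (x + t *\<^sub>R a) = rad x" by (simp add: rad_def u_def inner_add_left aa ab)
      moreover have "rad x > 0" using lt zero_le_power2 le_less_trans by blast
      ultimately have "x + t *\<^sub>R a \<in> S\<^sub>0" using t by (simp add: S\<^sub>0_def)
      then have "h (x + t *\<^sub>R a) \<le> T" using max by (simp add: T_def)
      then have "x \<bullet> a + t + sqrt (rad x) \<le> T"
        by (simp add: h_def \<open>rad (x + t *\<^sub>R a) = rad x\<close> inner_add_left aa)
      moreover have "T - x \<bullet> a < sqrt (rad x)" using lt by (rule real_less_rsqrt)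
      ultimately show False using t by linarith
    qed
  qed
  have s_at: "s x = sqrt ((x \<bullet> a - T)\<^sup>2 + (x \<bullet> axis 3 1 - d / 2)\<^sup>2)" for x
    by (simp add: s_def)
  have "2 - R / s p \<le> 2 * H * r"
  proof (rule torus_comparison[where a=a and b=b and v=a and R=R and c="axis 3 1" and \<alpha>=T and \<gamma>="d / 2", folded s_at, OF cmc p(1)])
    show "norm (axis 3 1 :: real^3) = 1" by (simp add: norm_axis_1)
    show "(p \<bullet> b)\<^sup>2 + (s p - R)\<^sup>2 = r\<^sup>2" using up(3) by (simp add: sp)
    show "a \<noteq> 0" using ab(1) by auto
    show "eventually (\<lambda>x. (x \<bullet> b)\<^sup>2 + (s x - R)\<^sup>2 > r\<^sup>2 \<longrightarrow> (\<forall>t\<ge>0. x + t *\<^sub>R a \<notin> S)) (nhds p)"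
      by (fact esc)
  qed (use p3 ab r spm m in \<open>simp_all add: inner_axis\<close>)
  moreover have "R / s p \<le> R / m" using spm m r by (intro divide_left_mono) (auto simp: R_def)
  moreover have "R / m = 1 + r / m" using m by (simp add: R_def add_divide_distrib)
  ultimately have "1 - r / m \<le> 2 * H * r" by linarith
  then have "(1 - r / m) / (2 * r) \<le> H" using r by (simp add: pos_divide_le_eq mult_ac)
  moreover have "(1 - r / m) / (2 * r) = 1 / (2 * r) - 1 / (2 * m)" using r m by (simp add: field_simps)
  ultimately show ?thesis by simp
qed

section \<open>The limiting torus and the explicit bound\<close>

text \<open>The estimate holds for all positive \<open>m\<close> strictly below \<open>M\<close>;
  the weak inequality survives the limit from the left.\<close>

lemma cmc_surface_mean_curvature_ge_limit:
  assumes cmc: "cmc_surface_in_cylinder r d S N H" and r: "0 < r" "r < d / 2"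
  shows "1 / (2 * r) - 4 * r / (d\<^sup>2 - 4 * r\<^sup>2) \<le> H"
proof -
  define M where "M = (d\<^sup>2 - 4 * r\<^sup>2) / (8 * r)"
  have "(2 * r)\<^sup>2 < d\<^sup>2" using r by (intro power_strict_mono) auto
  then have D: "d\<^sup>2 - 4 * r\<^sup>2 > 0" by (simp add: power_mult_distrib)
  then have M: "M > 0" using r by (simp add: M_def)
  have "((\<lambda>m. 1 / (2 * r) - 1 / (2 * m)) \<longlongrightarrow> 1 / (2 * r) - 1 / (2 * M)) (at_left M)"
    using M r by (auto intro!: tendsto_intros)
  moreover have "eventually (\<lambda>m. 1 / (2 * r) - 1 / (2 * m) \<le> H) (at_left M)"
    using eventually_at_left_real[OF M]
    by eventually_elim (use cmc_surface_mean_curvature_ge[OF cmc r] r in \<open>auto simp: M_def field_simps\<close>)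
  ultimately have "1 / (2 * r) - 1 / (2 * M) \<le> H"
    using tendsto_upperbound trivial_limit_at_left_real by blast
  moreover have "1 / (2 * M) = 4 * r / (d\<^sup>2 - 4 * r\<^sup>2)" using r D by (simp add: M_def field_simps)
  ultimately show ?thesis by simp
qed

text \<open>Writing \<open>d\<^sup>2 - 12 * r\<^sup>2\<close> as
  \<open>(d\<^sup>2 - 4 * r\<^sup>2) - 8 * r\<^sup>2\<close> identifies the first term with the
  limiting torus bound; the positive remainder makes the final inequality strict.\<close>

lemma mean_curvature_bound_decomposition:
  assumes "0 < r" "r < d / 2"
  shows "mean_curvature_bound r d =
    1 / (2 * r) - 4 * r / (d\<^sup>2 - 4 * r\<^sup>2) - 32 * r\<^sup>2 * d\<^sup>2 / (d\<^sup>2 - 4 * r\<^sup>2) ^ 3"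
    and "32 * r\<^sup>2 * d\<^sup>2 / (d\<^sup>2 - 4 * r\<^sup>2) ^ 3 > 0"
proof -
  have "(2 * r)\<^sup>2 < d\<^sup>2" using assms by (intro power_strict_mono) auto
  then have D: "d\<^sup>2 - 4 * r\<^sup>2 > 0" by (simp add: power_mult_distrib)
  have "(d\<^sup>2 - 12 * r\<^sup>2) / (2 * r * (d\<^sup>2 - 4 * r\<^sup>2)) = 1 / (2 * r) - 4 * r / (d\<^sup>2 - 4 * r\<^sup>2)"
    using D assms by (simp add: divide_simps) (simp add: algebra_simps power2_eq_square)
  then show "mean_curvature_bound r d =
    1 / (2 * r) - 4 * r / (d\<^sup>2 - 4 * r\<^sup>2) - 32 * r\<^sup>2 * d\<^sup>2 / (d\<^sup>2 - 4 * r\<^sup>2) ^ 3"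
    by (simp add: mean_curvature_bound_def)
  show "32 * r\<^sup>2 * d\<^sup>2 / (d\<^sup>2 - 4 * r\<^sup>2) ^ 3 > 0" using D assms by simp
qed


section \<open>The round cylinder\<close>

text \<open>Differentiating the equation of the cylinder along a curve makes its velocity orthogonal
  to the normal. Conversely, the vertical line and the rotation of \<open>p\<close> about the axis
  realise both spanning directions.\<close>

lemma round_cylinder_tangent_space:
  fixes p :: "real^3"
  assumes r: "r > 0" and p: "p \<in> round_cylinder r"
  defines "e \<equiv> vector [- p$2 / r, p$1 / r, 0] :: real^3"
  shows "norm e = 1" "e \<bullet> axis 3 1 = 0" "tangent_space (round_cylinder r) p = span {e, axis 3 1}"
    "round_cylinder_normal r p \<bullet> e = 0" "round_cylinder_normal r p \<bullet> axis 3 1 = 0"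
    "norm (round_cylinder_normal r p) = 1"
proof -
  let ?C = "round_cylinder r" and ?n = "round_cylinder_normal r p" and ?c = "axis 3 1 :: real^3"
  have pr: "(p$1)\<^sup>2 + (p$2)\<^sup>2 = r\<^sup>2" using p by (simp add: round_cylinder_def)
  have "e \<bullet> e = ((p$1)\<^sup>2 + (p$2)\<^sup>2) / r\<^sup>2" "?n \<bullet> ?n = ((p$1)\<^sup>2 + (p$2)\<^sup>2) / r\<^sup>2"
    by (simp_all add: e_def round_cylinder_normal_def inner_vec_def sum_3 power2_eq_square add_divide_distrib)
  then show e1: "norm e = 1" and n1: "norm ?n = 1"
    using pr r by (simp_all add: norm_eq_sqrt_inner)
  show ec: "e \<bullet> ?c = 0" and nc: "?n \<bullet> ?c = 0"
    by (simp_all add: e_def round_cylinder_normal_def inner_axis)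
  show ne: "?n \<bullet> e = 0" by (simp add: e_def round_cylinder_normal_def inner_vec_def sum_3)
  show "tangent_space ?C p = span {e, ?c}"
  proof
    show "tangent_space ?C p \<subseteq> span {e, ?c}"
      unfolding tangent_space_def
    proof (rule span_minimal, clarify)
      fix v and \<gamma> :: "real \<Rightarrow> real^3" and \<epsilon> :: real
      assume \<epsilon>: "\<epsilon> > 0" and C: "\<gamma> ` {0..<\<epsilon>} \<subseteq> ?C" and p0: "p = \<gamma> 0"
        and v: "(\<gamma> has_vector_derivative v) (at 0 within {0..<\<epsilon>})"
      have dc: "((\<lambda>t. \<gamma> t $ i) has_real_derivative v $ i) (at 0 within {0..<\<epsilon>})" for i
        using bounded_linear.has_vector_derivative[OF bounded_linear_vec_nth v]
        by (simp add: has_real_derivative_iff_has_vector_derivative)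
      have "((\<lambda>t. (\<gamma> t $ 1)\<^sup>2 + (\<gamma> t $ 2)\<^sup>2) has_real_derivative 2 * (p$1 * v$1 + p$2 * v$2))
              (at 0 within {0..<\<epsilon>})"
        by (auto intro!: derivative_eq_intros dc simp: p0)
      then have "((\<lambda>t. r\<^sup>2) has_vector_derivative 2 * (p$1 * v$1 + p$2 * v$2)) (at 0 within {0..<\<epsilon>})"
        unfolding has_real_derivative_iff_has_vector_derivative
        by (rule has_vector_derivative_transform[rotated 2])
          (use \<epsilon> C in \<open>force simp: round_cylinder_def\<close>)+
      then have "p$1 * v$1 + p$2 * v$2 = 0"
        using vector_derivative_unique_within[OF at_within_half_open_nontrivial[OF \<epsilon>]
            _ has_vector_derivative_const] by fastforce
      then have "v \<bullet> ?n = 0"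
        by (simp add: round_cylinder_normal_def inner_vec_def sum_3 field_simps)
          (use r in \<open>simp add: field_simps\<close>)
      then have "v = (v \<bullet> e) *\<^sub>R e + (v \<bullet> ?c) *\<^sub>R ?c"
        using orthonormal_expansion[OF e1 _ n1 ec ne nc, of v] by (simp add: norm_axis_1)
      then show "v \<in> span {e, ?c}"
        by (metis span_add span_base span_scale insertI1 insertI2)
    qed (rule subspace_span)
    have "?c \<in> tangent_space ?C p"
    proof (rule tangent_space_velocity[of 1 "\<lambda>t. p + t *\<^sub>R ?c"])
      show "((\<lambda>t. p + t *\<^sub>R ?c) has_vector_derivative ?c) (at 0)"
        by (auto intro!: derivative_eq_intros)
    qed (use p in \<open>auto simp: round_cylinder_def axis_def\<close>)
    moreover have "e \<in> tangent_space ?C p"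
    proof -
      define a b :: "real^3" where "a = vector [p$1, p$2, 0]" and "b = vector [- p$2, p$1, 0]"
      have "b \<in> tangent_space ?C p"
      proof (rule tangent_space_velocity[of 1 "\<lambda>t. cos t *\<^sub>R a + sin t *\<^sub>R b + p$3 *\<^sub>R ?c"])
        show "((\<lambda>t. cos t *\<^sub>R a + sin t *\<^sub>R b + p$3 *\<^sub>R ?c) has_vector_derivative b) (at 0)"
          by (auto intro!: derivative_eq_intros)
        show "cos 0 *\<^sub>R a + sin 0 *\<^sub>R b + p$3 *\<^sub>R ?c = p"
          by (simp add: vec_eq_iff forall_3 a_def axis_def)
        fix t :: real
        have "(cos t * p$1 - sin t * p$2)\<^sup>2 + (cos t * p$2 + sin t * p$1)\<^sup>2 =
            ((cos t)\<^sup>2 + (sin t)\<^sup>2) * ((p$1)\<^sup>2 + (p$2)\<^sup>2)"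
          by (simp only: power2_eq_square) algebra
        then show "cos t *\<^sub>R a + sin t *\<^sub>R b + p$3 *\<^sub>R ?c \<in> ?C"
          using pr by (simp add: round_cylinder_def a_def b_def axis_def)
      qed simp
      then have "(1 / r) *\<^sub>R b \<in> tangent_space ?C p"
        unfolding tangent_space_def by (rule span_scale)
      also have "(1 / r) *\<^sub>R b = e" by (simp add: vec_eq_iff forall_3 b_def e_def)
      finally show ?thesis .
    qed
    ultimately show "span {e, ?c} \<subseteq> tangent_space ?C p"
      unfolding tangent_space_def by (intro span_minimal subspace_span) auto
  qed
qed

text \<open>The normal field is the restriction of a linear map, hence its own derivative, with
  eigenvectors in the horizontal and vertical tangent directions.\<close>

lemma round_cylinder_mean_curvature:
  assumes r: "r > 0"
  shows "has_constant_mean_curvature (round_cylinder r) (round_cylinder_normal r) (1 / (2 * r))"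
proof -
  let ?N = "round_cylinder_normal r"
  have N: "?N = (\<lambda>x. (- 1 / r) *\<^sub>R (x$1 *\<^sub>R axis 1 1 + x$2 *\<^sub>R axis 2 1))"
    by (auto simp: fun_eq_iff vec_eq_iff forall_3 round_cylinder_normal_def axis_def)
  have lin: "bounded_linear ?N"
    unfolding N
    by (intro bounded_linear_scaleR_right bounded_linear_const_scaleR bounded_linear_add bounded_linear_scaleR_const bounded_linear_vec_nth)
  show ?thesis
    unfolding has_constant_mean_curvature_def unit_normal_field_def
  proof (intro conjI ballI)
    show "continuous_on (round_cylinder r) ?N"
      using lin linear_continuous_on by blast
    fix p assume p: "p \<in> round_cylinder r"
    note T = round_cylinder_tangent_space[OF r p]
    show "norm (?N p) = 1" by (fact T(6))
    show "?N p \<bullet> v = 0" if "v \<in> tangent_space (round_cylinder r) p" for v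
      using orthogonal_to_span[of v _ "?N p"] that T(4,5) unfolding T(3) by (auto simp: orthogonal_def)
    have "principal_curvatures (round_cylinder r) ?N p (1 / r) 0"
      unfolding principal_curvatures_def
    proof (intro exI conjI)
      show "(?N has_derivative ?N) (at p within round_cylinder r)"
        using lin by (rule bounded_linear_imp_has_derivative)
      show "- ?N (vector [- p$2 / r, p$1 / r, 0]) = (1 / r) *\<^sub>R vector [- p$2 / r, p$1 / r, 0]"
        "- ?N (axis 3 1) = 0 *\<^sub>R axis 3 1"
        by (simp_all add: vec_eq_iff forall_3 round_cylinder_normal_def axis_def)
    qed (fact T(1-3) | simp add: norm_axis_1)+
    then show "has_mean_curvature (round_cylinder r) ?N p (1 / (2 * r))"
      unfolding has_mean_curvature_def by (intro exI conjI) auto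
  qed
qed

section \<open>Limit of the bound and conclusion\<close>

lemma mean_curvature_bound_tendsto:
  assumes "r > 0"
  shows "(mean_curvature_bound r \<longlongrightarrow> 1 / (2 * r)) at_top"
  unfolding mean_curvature_bound_def using assms by real_asymp (simp add: field_simps)

text \<open>In the second conjunct \<open>K\<close> is chosen before \<open>r\<close>, which
  expresses "large relative to \<open>r\<close>"; \<open>c\<close> depends on \<open>r\<close>
  because curvature scales like an inverse length.\<close>

theorem proposition4p1:
  shows
    "(\<forall>(r::real) (d::real) S N H.
        0 < r \<and> r < d / 2 \<and> cmc_surface_in_cylinder r d S N H \<longrightarrow>
        H > mean_curvature_bound r d) \<and>
     (\<exists>K::real. \<forall>r>0. \<exists>c>0. \<forall>d S N H.
        r < d / 2 \<and> d \<ge> K * r \<and> cmc_surface_in_cylinder r d S N H \<longrightarrow> H \<ge> c) \<and>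
     (\<forall>r>0. \<exists>h::real.
        has_constant_mean_curvature (round_cylinder r) (round_cylinder_normal r) h \<and>
        ((\<lambda>d. mean_curvature_bound r d) \<longlongrightarrow> h) at_top)"
proof (intro conjI)
  show "\<forall>(r::real) (d::real) S N H.
        0 < r \<and> r < d / 2 \<and> cmc_surface_in_cylinder r d S N H \<longrightarrow>
        H > mean_curvature_bound r d"
  proof (intro allI impI, elim conjE)
    fix r d :: real and S N H
    assume r: "0 < r" "r < d / 2" and cmc: "cmc_surface_in_cylinder r d S N H"
    show "H > mean_curvature_bound r d"
      using cmc_surface_mean_curvature_ge_limit[OF cmc r] mean_curvature_bound_decomposition[OF r] by linarith
  qed
  show "\<exists>K::real. \<forall>r>0. \<exists>c>0. \<forall>d S N H.
        r < d / 2 \<and> d \<ge> K * r \<and> cmc_surface_in_cylinder r d S N H \<longrightarrow> H \<ge> c"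
  \<comment> \<open>With \<open>d \<ge> 5 * r\<close> the denominator
    \<open>d\<^sup>2 - 4 * r\<^sup>2\<close> is at least \<open>16 * r\<^sup>2\<close>, so the
    subtracted term is at most \<open>1 / (4 * r)\<close>, half of the leading term
    \<open>1 / (2 * r)\<close>.\<close>
  proof (rule exI[of _ 5], intro allI impI)
    fix r :: real assume "r > 0"
    show "\<exists>c>0. \<forall>d S N H. r < d / 2 \<and> d \<ge> 5 * r \<and> cmc_surface_in_cylinder r d S N H \<longrightarrow> H \<ge> c"
    proof (intro exI conjI allI impI; (elim conjE)?)
      show "1 / (4 * r) > 0" using \<open>r > 0\<close> by simp
      fix d S N H
      assume r: "r < d / 2" and d: "d \<ge> 5 * r" and cmc: "cmc_surface_in_cylinder r d S N H"
      have "(5 * r)\<^sup>2 \<le> d\<^sup>2" using d \<open>r > 0\<close> by (intro power_mono) auto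
      then have "25 * r\<^sup>2 \<le> d\<^sup>2" by (simp add: power_mult_distrib)
      then have "16 * r\<^sup>2 \<le> d\<^sup>2 - 4 * r\<^sup>2" using zero_le_power2[of r] by linarith
      moreover have "16 * r\<^sup>2 > 0" using \<open>r > 0\<close> by simp
      ultimately have "4 * r / (d\<^sup>2 - 4 * r\<^sup>2) \<le> 4 * r / (16 * r\<^sup>2)"
        using \<open>r > 0\<close> by (intro frac_le) simp_all
      also have "\<dots> = 1 / (2 * r) - 1 / (4 * r)" using \<open>r > 0\<close> by (simp add: field_simps power2_eq_square)
      finally show "1 / (4 * r) \<le> H"
        using cmc_surface_mean_curvature_ge_limit[OF cmc \<open>r > 0\<close> r] by simp
    qed
  qed
  show "\<forall>r>0. \<exists>h::real.
        has_constant_mean_curvature (round_cylinder r) (round_cylinder_normal r) h \<and>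
        ((\<lambda>d. mean_curvature_bound r d) \<longlongrightarrow> h) at_top"
    using round_cylinder_mean_curvature mean_curvature_bound_tendsto by blast
qed

end
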